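(* There exists a contraction $T$ on a separable Hilbert space $\mathcal{H}$ that satisfies all of the following: (i) $\mathcal{I}(T_{11},T_{00})=\{0\}$; (ii) $\{\bar\lambda:\lambda\in\sigma_{ap}(T_{00}^* )\}\cap\sigma_{ap}(T_{11})\neq\emptyset$; (iii) $\sigma_p(T)\cap\{\bar\lambda:\lambda\in\sigma_p(T^* )\}\cap\mathbb{D}=\emptyset$; (iv) there is no direct sum decomposition $\mathcal{H}=\mathcal{M}_0\dotplus\mathcal{M}_1$ into closed $T$-invariant subspaces with $\{0\}\neq\mathcal{M}_0\subseteq\mathcal{H}_0$; but whose commutant mapping $\gamma_T$ is not injective.
   Context: For a contraction $T$, $A_T$ is the strong-operator limit of $T^{*n}T^n$, $\mathcal{H}_0=\{x:\|T^nx\|\to0\}$, $P_0$ the orthogonal projection onto $\mathcal{H}_0$, $T_{00}=P_0T|\mathcal{H}_0$, $T_{11}=(I-P_0)T|\mathcal{H}_0^\perp$. $\mathcal{I}(A,B)=\{X:XA=BX\}$. The commutant mapping $\gamma_T:\{T\}'\to\{W_T\}'$ sends $C$ to the unique $D$ commuting with $W_T$ with $X_TC=DX_T$, where $X_Tx=A_T^{1/2}x$ and $W_T$ is the minimal unitary dilation of the unique isometry $V_T$ on $\overline{\operatorname{ran}A_T}$ with $A_T^{1/2}T=V_TA_T^{1/2}$. $\sigma_p$, $\sigma_{ap}$ denote point and approximate point spectrum; $\mathbb{D}$ the open unit disc. *)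

theory Defs
  imports Complex_Main
begin

text \<open>Concrete model: complex sequence space; separable Hilbert spaces are modelled
  as closed subspaces of l2(N) (every separable Hilbert space is unitarily
  equivalent to such a subspace). Operators are functions considered on a carrier.\<close>

type_synonym vec = "nat \<Rightarrow> complex"
type_synonym op = "vec \<Rightarrow> vec"

definition vadd :: "vec \<Rightarrow> vec \<Rightarrow> vec" where "vadd x y = (\<lambda>k. x k + y k)"
definition vsub :: "vec \<Rightarrow> vec \<Rightarrow> vec" where "vsub x y = (\<lambda>k. x k - y k)"
definition smul :: "complex \<Rightarrow> vec \<Rightarrow> vec" where "smul c x = (\<lambda>k. c * x k)"
definition vzero :: vec where "vzero = (\<lambda>k. 0)"

definition l2 :: "vec set" where "l2 = {x. summable (\<lambda>k. (cmod (x k))^2)}"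
definition l2norm :: "vec \<Rightarrow> real" where "l2norm x = sqrt (\<Sum>k. (cmod (x k))^2)"
definition l2inner :: "vec \<Rightarrow> vec \<Rightarrow> complex" where
  "l2inner x y = (\<Sum>k. x k * cnj (y k))"

definition l2conv :: "(nat \<Rightarrow> vec) \<Rightarrow> vec \<Rightarrow> bool" where
  "l2conv s x \<longleftrightarrow> x \<in> l2 \<and> (\<lambda>n. l2norm (vsub (s n) x)) \<longlonglongrightarrow> 0"

definition l2closure :: "vec set \<Rightarrow> vec set" where
  "l2closure S = {x. \<exists>s. (\<forall>n. s n \<in> S) \<and> l2conv s x}"

definition lin_subspace :: "vec set \<Rightarrow> bool" where
  "lin_subspace S \<longleftrightarrow> S \<subseteq> l2 \<and> vzero \<in> S \<and> (\<forall>x\<in>S. \<forall>y\<in>S. vadd x y \<in> S)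
     \<and> (\<forall>c. \<forall>x\<in>S. smul c x \<in> S)"

definition closed_subspace :: "vec set \<Rightarrow> bool" where
  "closed_subspace S \<longleftrightarrow> lin_subspace S \<and> l2closure S \<subseteq> S"

definition lin_span :: "vec set \<Rightarrow> vec set" where
  "lin_span S = {x. \<exists>(n::nat) (c::nat \<Rightarrow> complex) (v::nat \<Rightarrow> vec). (\<forall>i<n. v i \<in> S) \<and> x = (\<lambda>k. \<Sum>i<n. c i * v i k)}"

definition closed_span :: "vec set \<Rightarrow> vec set" where
  "closed_span S = l2closure (lin_span S)"

definition bounded_op :: "vec set \<Rightarrow> vec set \<Rightarrow> op \<Rightarrow> bool" where
  "bounded_op H K T \<longleftrightarrow> (\<forall>x\<in>H. T x \<in> K)
     \<and> (\<forall>x\<in>H. \<forall>y\<in>H. T (vadd x y) = vadd (T x) (T y))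
     \<and> (\<forall>c. \<forall>x\<in>H. T (smul c x) = smul c (T x))
     \<and> (\<exists>B. \<forall>x\<in>H. l2norm (T x) \<le> B * l2norm x)"

definition contraction :: "vec set \<Rightarrow> op \<Rightarrow> bool" where
  "contraction H T \<longleftrightarrow> bounded_op H H T \<and> (\<forall>x\<in>H. l2norm (T x) \<le> l2norm x)"

definition is_adjoint :: "vec set \<Rightarrow> vec set \<Rightarrow> op \<Rightarrow> op \<Rightarrow> bool" where
  "is_adjoint H K T S \<longleftrightarrow> bounded_op K H S \<and>
     (\<forall>x\<in>H. \<forall>y\<in>K. l2inner (T x) y = l2inner x (S y))"

text \<open>Adjoint of T : H \<rightarrow> K (unique on K).\<close>
definition adj :: "vec set \<Rightarrow> vec set \<Rightarrow> op \<Rightarrow> op" where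
  "adj H K T = (SOME S. is_adjoint H K T S)"

definition unitary_op :: "vec set \<Rightarrow> op \<Rightarrow> bool" where
  "unitary_op K W \<longleftrightarrow> bounded_op K K W \<and> (\<forall>x\<in>K. l2norm (W x) = l2norm x) \<and> W ` K = K"

definition point_spec :: "vec set \<Rightarrow> op \<Rightarrow> complex set" where
  "point_spec H T = {l. \<exists>x\<in>H. x \<noteq> vzero \<and> T x = smul l x}"

definition approx_point_spec :: "vec set \<Rightarrow> op \<Rightarrow> complex set" where
  "approx_point_spec H T = {l. \<exists>s. (\<forall>n. s n \<in> H \<and> l2norm (s n) = 1) \<and>
      (\<lambda>n. l2norm (vsub (T (s n)) (smul l (s n)))) \<longlonglongrightarrow> 0}"

definition stable_sub :: "vec set \<Rightarrow> op \<Rightarrow> vec set" where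
  "stable_sub H T = {x\<in>H. (\<lambda>n. l2norm ((T^^n) x)) \<longlonglongrightarrow> 0}"

definition orth_proj :: "vec set \<Rightarrow> vec \<Rightarrow> vec" where
  "orth_proj M x = (THE y. y \<in> M \<and> (\<forall>z\<in>M. l2inner (vsub x y) z = 0))"

definition orth_compl :: "vec set \<Rightarrow> vec set \<Rightarrow> vec set" where
  "orth_compl H M = {x\<in>H. \<forall>y\<in>M. l2inner x y = 0}"

definition T00 :: "vec set \<Rightarrow> op \<Rightarrow> op" where
  "T00 H T = (\<lambda>x. orth_proj (stable_sub H T) (T x))"

definition T11 :: "vec set \<Rightarrow> op \<Rightarrow> op" where
  "T11 H T = (\<lambda>x. vsub (T x) (orth_proj (stable_sub H T) (T x)))"

definition intertw :: "vec set \<Rightarrow> vec set \<Rightarrow> op \<Rightarrow> op \<Rightarrow> op set" where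
  "intertw H K A B = {X. bounded_op H K X \<and> (\<forall>x\<in>H. X (A x) = B (X x))}"

definition commutant :: "vec set \<Rightarrow> op \<Rightarrow> op set" where
  "commutant H T = intertw H H T T"

definition A_T :: "vec set \<Rightarrow> op \<Rightarrow> op" where
  "A_T H T = (\<lambda>x. THE y. l2conv (\<lambda>n. ((adj H H T)^^n) ((T^^n) x)) y)"

definition sqrt_op :: "vec set \<Rightarrow> op \<Rightarrow> op" where
  "sqrt_op H A = (THE S. bounded_op H H S
      \<and> (\<forall>x\<in>H. Im (l2inner (S x) x) = 0 \<and> Re (l2inner (S x) x) \<ge> 0)
      \<and> (\<forall>x\<in>H. S (S x) = A x) \<and> (\<forall>x. x \<notin> H \<longrightarrow> S x = vzero))"

definition X_T :: "vec set \<Rightarrow> op \<Rightarrow> op" where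
  "X_T H T = sqrt_op H (A_T H T)"

definition Hplus :: "vec set \<Rightarrow> op \<Rightarrow> vec set" where
  "Hplus H T = l2closure (A_T H T ` H)"

definition V_T :: "vec set \<Rightarrow> op \<Rightarrow> op" where
  "V_T H T = (THE V. bounded_op (Hplus H T) (Hplus H T) V
      \<and> (\<forall>x\<in>Hplus H T. l2norm (V x) = l2norm x)
      \<and> (\<forall>x\<in>H. X_T H T (T x) = V (X_T H T x))
      \<and> (\<forall>x. x \<notin> Hplus H T \<longrightarrow> V x = vzero))"

definition min_unitary_dilation :: "vec set \<Rightarrow> op \<Rightarrow> vec set \<Rightarrow> op \<Rightarrow> op \<Rightarrow> bool" where
  "min_unitary_dilation Hp V K J W \<longleftrightarrow> closed_subspace K \<and> bounded_op Hp K J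
     \<and> (\<forall>x\<in>Hp. l2norm (J x) = l2norm x) \<and> unitary_op K W
     \<and> (\<forall>x\<in>Hp. W (J x) = J (V x))
     \<and> K = closed_span (\<Union>n. ((adj K K W)^^n) ` J ` Hp)"

text \<open>Graph of the commutant mapping gamma_T w.r.t. the dilation (K,J,W):
  D = gamma_T(C) iff D \<in> {W}' and X_T C = D X_T (X_T viewed in K via J).\<close>
definition gamma_rel :: "vec set \<Rightarrow> op \<Rightarrow> vec set \<Rightarrow> op \<Rightarrow> op \<Rightarrow> op \<Rightarrow> op \<Rightarrow> bool" where
  "gamma_rel H T K J W C D \<longleftrightarrow> C \<in> commutant H T \<and> D \<in> commutant K W
     \<and> (\<forall>x\<in>H. J (X_T H T (C x)) = D (J (X_T H T x)))"

end

theory Submission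
  imports "HOL-Analysis.Summation_Tests" "HOL-Analysis.Uniform_Limit" Defs
begin

text \<open>On the orthonormal basis \<open>e\<^sub>k\<close> (\<open>k \<in> \<int>\<close>), \<open>f\<^sub>j\<close> (\<open>j \<in> \<nat>\<close>) let \<open>T e\<^sub>k = e\<^bsub>k+1\<^esub>\<close> for \<open>k \<ge> 0\<close>,
  \<open>T e\<^sub>k = e\<^bsub>k+1\<^esub>/2 + 2\<^bsup>k\<^esup> f\<^sub>0\<close> for \<open>k < 0\<close>, and let \<open>T\<close> act on the \<open>f\<^sub>j\<close> as the injective weighted shift
  \<open>S\<close> whose weights have the partial products \<open>p\<^sub>j = (j+1)\<^bsup>-1/2\<^esup>\<close>. Since \<open>p\<^sub>j\<close> tends to \<open>0\<close>, the span of
  the \<open>f\<^sub>j\<close> is \<open>H\<^sub>0\<close>, and \<open>A\<^sub>T\<close> is diagonal.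

  \<open>T\<^bsub>11\<^esub>\<close> is invertible and the ranges of the powers of \<open>S\<close> intersect in \<open>0\<close>, so nothing intertwines
  \<open>T\<^bsub>11\<^esub>\<close> with \<open>S\<close>. As \<open>H\<^sub>0/SH\<^sub>0\<close> is one-dimensional, an invariant summand inside \<open>H\<^sub>0\<close> must be all of
  \<open>H\<^sub>0\<close>, and its complement is then the graph of the unique solution \<open>Z\<close> of
  \<open>Z T\<^bsub>11\<^esub> = S Z + P\<^sub>0 T\<close>; but \<open>Z e\<^sub>0 = \<Sum> p\<^sub>j f\<^sub>j\<close> is not square summable. The product \<open>(I - S) Z\<close> is
  nevertheless bounded, and \<open>C = (I - S)(P\<^sub>0 - Z (I - P\<^sub>0))\<close> commutes with \<open>T\<close>, is nonzero, and has range
  in \<open>H\<^sub>0 = ker X\<^sub>T\<close>, so the commutant mapping sends both \<open>C\<close> and \<open>0\<close> to \<open>0\<close>.\<close>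

section \<open>The sequence space\<close>

lemma l2_iff: "x \<in> l2 \<longleftrightarrow> summable (\<lambda>k. (cmod (x k))\<^sup>2)"
  by (simp add: l2_def)

lemma vec_apply [simp]:
  "vadd x y k = x k + y k" "vsub x y k = x k - y k" "smul c x k = c * x k" "vzero k = 0"
  by (simp_all add: vadd_def vsub_def smul_def vzero_def)

lemma l2norm_nonneg [simp]: "x \<in> l2 \<Longrightarrow> 0 \<le> l2norm x"
  by (simp add: l2norm_def l2_iff suminf_nonneg)

lemma l2norm_power2: "x \<in> l2 \<Longrightarrow> (l2norm x)\<^sup>2 = (\<Sum>k. (cmod (x k))\<^sup>2)"
  by (simp add: l2norm_def l2_iff suminf_nonneg)

text \<open>A single coordinatewise bound gives membership and the norm estimate together; the
  weights, \<open>opA\<close> and \<open>defectA\<close> are controlled through it.\<close>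

lemma l2_dominated:
  assumes "y \<in> l2" and le: "\<And>k. cmod (x k) \<le> B * cmod (y k)" and B: "0 \<le> B"
  shows "x \<in> l2" and "l2norm x \<le> B * l2norm y"
proof -
  have le2: "(cmod (x k))\<^sup>2 \<le> B\<^sup>2 * (cmod (y k))\<^sup>2" for k
    using power_mono[OF le[of k], of 2] by (simp add: power_mult_distrib)
  have s: "summable (\<lambda>k. B\<^sup>2 * (cmod (y k))\<^sup>2)"
    using assms(1) by (simp add: l2_iff summable_mult)
  show x: "x \<in> l2"
    unfolding l2_iff by (rule summable_comparison_test'[OF s, of 0]) (use le2 in simp)
  have "(l2norm x)\<^sup>2 \<le> (\<Sum>k. B\<^sup>2 * (cmod (y k))\<^sup>2)"
    unfolding l2norm_power2[OF x] by (rule suminf_le[OF le2 _ s]) (use x in \<open>simp add: l2_iff\<close>)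
  also have "\<dots> = (B * l2norm y)\<^sup>2"
    using assms(1) by (simp add: l2norm_power2 power_mult_distrib suminf_mult l2_iff)
  finally show "l2norm x \<le> B * l2norm y"
    using B assms(1) by (meson power2_le_imp_le mult_nonneg_nonneg l2norm_nonneg)
qed

lemma vzero_in_l2 [simp]: "vzero \<in> l2"
  by (simp add: l2_iff)

lemma l2norm_vzero [simp]: "l2norm vzero = 0"
  by (simp add: l2norm_def)

lemma l2norm_eq_0D:
  assumes "x \<in> l2" "l2norm x = 0" shows "x = vzero"
proof -
  have "(\<Sum>k. (cmod (x k))\<^sup>2) = 0" using l2norm_power2[OF assms(1)] assms(2) by simp
  then have "\<forall>k. (cmod (x k))\<^sup>2 = 0"
    using assms(1) by (subst (asm) suminf_eq_zero_iff) (auto simp: l2_iff)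
  then show ?thesis by (auto simp: fun_eq_iff)
qed

lemma l2_smul [simp]: "x \<in> l2 \<Longrightarrow> smul c x \<in> l2"
  by (rule l2_dominated(1)[where B = "cmod c" and y = x]) (simp_all add: norm_mult)

lemma l2norm_smul:
  assumes "x \<in> l2" shows "l2norm (smul c x) = cmod c * l2norm x"
proof -
  have "(l2norm (smul c x))\<^sup>2 = (cmod c * l2norm x)\<^sup>2"
    using assms by (simp add: l2norm_power2 norm_mult power_mult_distrib suminf_mult l2_iff)
  then show ?thesis using assms
    by (meson power2_eq_iff_nonneg mult_nonneg_nonneg l2norm_nonneg l2_smul norm_ge_zero)
qed

lemma cmod_mult_cnj_le: "cmod (a * cnj b) \<le> (cmod a)\<^sup>2 + (cmod b)\<^sup>2"
proof -
  have "0 \<le> cmod a * cmod b" by simp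
  moreover have "2 * (cmod a * cmod b) \<le> (cmod a)\<^sup>2 + (cmod b)\<^sup>2"
    using sum_squares_bound[of "cmod a" "cmod b"] by (simp add: mult.assoc)
  ultimately show ?thesis unfolding norm_mult complex_mod_cnj by linarith
qed

lemma l2inner_summable_norm:
  assumes "x \<in> l2" "y \<in> l2"
  shows "summable (\<lambda>k. cmod (x k * cnj (y k)))"
proof (rule summable_comparison_test'[of "\<lambda>k. (cmod (x k))\<^sup>2 + (cmod (y k))\<^sup>2" 0])
  show "summable (\<lambda>k. (cmod (x k))\<^sup>2 + (cmod (y k))\<^sup>2)"
    using assms by (simp add: l2_iff summable_add)
qed (use cmod_mult_cnj_le in simp)

lemma l2inner_summable:
  "x \<in> l2 \<Longrightarrow> y \<in> l2 \<Longrightarrow> summable (\<lambda>k. x k * cnj (y k))"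
  by (rule summable_norm_cancel[OF l2inner_summable_norm])

lemma l2_vadd [simp]:
  assumes "x \<in> l2" "y \<in> l2" shows "vadd x y \<in> l2"
  unfolding l2_iff
proof (rule summable_comparison_test'[of "\<lambda>k. 2 * (cmod (x k))\<^sup>2 + 2 * (cmod (y k))\<^sup>2" 0])
  show "summable (\<lambda>k. 2 * (cmod (x k))\<^sup>2 + 2 * (cmod (y k))\<^sup>2)"
    using assms by (simp add: l2_iff summable_add summable_mult)
  fix k
  have "(cmod (x k + y k))\<^sup>2 \<le> (cmod (x k) + cmod (y k))\<^sup>2"
    by (rule power_mono) (simp_all add: norm_triangle_ineq)
  also have "\<dots> \<le> 2 * (cmod (x k))\<^sup>2 + 2 * (cmod (y k))\<^sup>2"
    using sum_squares_bound[of "cmod (x k)" "cmod (y k)"] by (simp add: power2_sum)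
  finally show "norm ((cmod (vadd x y k))\<^sup>2) \<le> 2 * (cmod (x k))\<^sup>2 + 2 * (cmod (y k))\<^sup>2" by simp
qed

lemma vsub_eq: "vsub x y = vadd x (smul (-1) y)"
  by (simp add: fun_eq_iff)

lemma l2_vsub [simp]: "x \<in> l2 \<Longrightarrow> y \<in> l2 \<Longrightarrow> vsub x y \<in> l2"
  by (simp add: vsub_eq)

lemma l2inner_vadd_left:
  "x \<in> l2 \<Longrightarrow> y \<in> l2 \<Longrightarrow> z \<in> l2 \<Longrightarrow> l2inner (vadd x y) z = l2inner x z + l2inner y z"
  by (simp add: l2inner_def distrib_right suminf_add l2inner_summable)

lemma l2inner_vadd_right:
  "x \<in> l2 \<Longrightarrow> y \<in> l2 \<Longrightarrow> z \<in> l2 \<Longrightarrow> l2inner z (vadd x y) = l2inner z x + l2inner z y"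
  by (simp add: l2inner_def distrib_left suminf_add l2inner_summable)

lemma l2inner_smul_left:
  "x \<in> l2 \<Longrightarrow> z \<in> l2 \<Longrightarrow> l2inner (smul c x) z = c * l2inner x z"
  by (simp add: l2inner_def mult.assoc suminf_mult l2inner_summable)

lemma l2inner_smul_right:
  "x \<in> l2 \<Longrightarrow> z \<in> l2 \<Longrightarrow> l2inner z (smul c x) = cnj c * l2inner z x"
  by (simp add: l2inner_def mult.left_commute[of _ "cnj c"] suminf_mult l2inner_summable)

lemmas l2inner_linear = l2inner_vadd_left l2inner_vadd_right l2inner_smul_left l2inner_smul_right

lemma l2inner_vsub_left:
  "x \<in> l2 \<Longrightarrow> y \<in> l2 \<Longrightarrow> z \<in> l2 \<Longrightarrow> l2inner (vsub x y) z = l2inner x z - l2inner y z"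
  by (simp add: vsub_eq l2inner_linear)

lemma l2inner_vsub_right:
  "x \<in> l2 \<Longrightarrow> y \<in> l2 \<Longrightarrow> z \<in> l2 \<Longrightarrow> l2inner z (vsub x y) = l2inner z x - l2inner z y"
  by (simp add: vsub_eq l2inner_linear)

lemma l2inner_vzero [simp]: "l2inner vzero x = 0" "l2inner x vzero = 0"
  by (simp_all add: l2inner_def)

lemma l2inner_commute:
  assumes "x \<in> l2" "y \<in> l2" shows "l2inner y x = cnj (l2inner x y)"
proof -
  have "(\<lambda>k. cnj (x k * cnj (y k))) sums cnj (l2inner x y)"
    unfolding l2inner_def sums_cnj by (rule summable_sums) (rule l2inner_summable[OF assms])
  then show ?thesis by (simp add: l2inner_def sums_iff mult.commute)
qed

lemma l2inner_self:
  assumes "x \<in> l2" shows "l2inner x x = of_real ((l2norm x)\<^sup>2)"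
proof -
  have "(\<lambda>k. complex_of_real ((cmod (x k))\<^sup>2)) sums of_real ((l2norm x)\<^sup>2)"
    unfolding l2norm_power2[OF assms] sums_of_real_iff
    by (rule summable_sums) (use assms in \<open>simp add: l2_iff\<close>)
  then show ?thesis by (simp add: l2inner_def sums_iff complex_norm_square del: of_real_power)
qed

lemma l2_Cauchy_Schwarz:
  assumes "x \<in> l2" "y \<in> l2" shows "cmod (l2inner x y) \<le> l2norm x * l2norm y"
proof (cases "l2norm x = 0")
  case True
  then show ?thesis using l2norm_eq_0D[OF assms(1)] by simp
next
  case False
  then have pos: "l2norm x > 0" using assms(1) l2norm_nonneg[of x] by linarith
  \<comment> \<open>\<open>z\<close> is the component of \<open>y\<close> orthogonal to
    \<open>x\<close>; the inequality expresses that its squared norm is nonnegative.\<close>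
  define c where "c = l2inner y x / of_real ((l2norm x)\<^sup>2)"
  define z where "z = vsub y (smul c x)"
  have z: "z \<in> l2" using assms by (simp add: z_def)
  have yx: "l2inner y x = cnj (l2inner x y)" by (rule l2inner_commute[OF assms])
  have 0: "l2inner z x = 0"
    using assms pos by (simp add: z_def c_def l2inner_vsub_left l2inner_linear l2inner_self)
  have "l2inner z z = l2inner z y"
    using assms z 0 by (subst (2) z_def) (simp add: l2inner_vsub_right l2inner_linear)
  also have "\<dots> = of_real ((l2norm y)\<^sup>2) - c * l2inner x y"
    using assms by (simp add: z_def l2inner_vsub_left l2inner_linear l2inner_self)
  also have "c * l2inner x y = of_real ((cmod (l2inner x y))\<^sup>2 / (l2norm x)\<^sup>2)"
    by (simp add: c_def yx complex_norm_square mult.commute del: of_real_power)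
  finally have "complex_of_real ((l2norm z)\<^sup>2)
      = of_real ((l2norm y)\<^sup>2 - (cmod (l2inner x y))\<^sup>2 / (l2norm x)\<^sup>2)"
    by (simp add: l2inner_self[OF z])
  then have "(l2norm z)\<^sup>2 = (l2norm y)\<^sup>2 - (cmod (l2inner x y))\<^sup>2 / (l2norm x)\<^sup>2"
    using of_real_eq_iff by blast
  then have "(cmod (l2inner x y))\<^sup>2 / (l2norm x)\<^sup>2 \<le> (l2norm y)\<^sup>2"
    using zero_le_power2[of "l2norm z"] by linarith
  then have "(cmod (l2inner x y))\<^sup>2 \<le> (l2norm x * l2norm y)\<^sup>2"
    using pos by (simp add: divide_le_eq power_mult_distrib mult.commute)
  then show ?thesis
    by (rule power2_le_imp_le) (use assms in simp)
qed

lemma l2norm_triangle: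
  assumes "x \<in> l2" "y \<in> l2" shows "l2norm (vadd x y) \<le> l2norm x + l2norm y"
proof (rule power2_le_imp_le)
  have "l2inner (vadd x y) (vadd x y)
      = of_real ((l2norm x)\<^sup>2 + (l2norm y)\<^sup>2) + (l2inner x y + cnj (l2inner x y))"
    using assms l2inner_commute[OF assms]
    by (simp add: l2inner_linear l2inner_self[OF assms(1)] l2inner_self[OF assms(2)])
  then have "complex_of_real ((l2norm (vadd x y))\<^sup>2)
      = of_real ((l2norm x)\<^sup>2 + (l2norm y)\<^sup>2 + 2 * Re (l2inner x y))"
    using assms by (simp add: l2inner_self complex_add_cnj)
  then have "(l2norm (vadd x y))\<^sup>2 = (l2norm x)\<^sup>2 + (l2norm y)\<^sup>2 + 2 * Re (l2inner x y)"
    using of_real_eq_iff by blast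
  also have "\<dots> \<le> (l2norm x + l2norm y)\<^sup>2"
    using l2_Cauchy_Schwarz[OF assms] complex_Re_le_cmod[of "l2inner x y"]
    by (simp add: power2_sum)
  finally show "(l2norm (vadd x y))\<^sup>2 \<le> (l2norm x + l2norm y)\<^sup>2" .
qed (use assms in simp)

lemma l2norm_vsub_le:
  "x \<in> l2 \<Longrightarrow> y \<in> l2 \<Longrightarrow> l2norm (vsub x y) \<le> l2norm x + l2norm y"
  using l2norm_triangle[of x "smul (-1) y"] by (simp add: vsub_eq l2norm_smul)

lemma l2inner_self_eq_0D: "x \<in> l2 \<Longrightarrow> l2inner x x = 0 \<Longrightarrow> x = vzero"
  by (simp add: l2inner_self l2norm_eq_0D)

lemma vsub_eq_vzeroD: "vsub x y = vzero \<Longrightarrow> x = y"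
  by (metis ext eq_iff_diff_eq_0 vec_apply(2,4))

section \<open>Subspaces and uniqueness of limits\<close>

lemma lin_subspace_l2: "lin_subspace l2"
  by (simp add: lin_subspace_def)

lemma closed_subspace_l2: "closed_subspace l2"
  by (auto simp: closed_subspace_def lin_subspace_l2 l2closure_def l2conv_def)

lemma lin_subspaceD:
  assumes "lin_subspace S"
  shows "x \<in> S \<Longrightarrow> x \<in> l2" "vzero \<in> S" "x \<in> S \<Longrightarrow> y \<in> S \<Longrightarrow> vadd x y \<in> S"
    "x \<in> S \<Longrightarrow> smul c x \<in> S" "x \<in> S \<Longrightarrow> y \<in> S \<Longrightarrow> vsub x y \<in> S"
  using assms by (auto simp: lin_subspace_def vsub_eq)

lemma l2conv_unique:
  assumes s: "\<And>n. s n \<in> l2" and "l2conv s x" "l2conv s y" shows "x = y"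
proof -
  have xy: "x \<in> l2" "y \<in> l2" using assms by (auto simp: l2conv_def)
  have "(\<lambda>n. l2norm (vsub (s n) y) + l2norm (vsub (s n) x)) \<longlonglongrightarrow> 0 + 0"
    using assms(2,3) unfolding l2conv_def by (intro tendsto_add) auto
  moreover have "l2norm (vsub x y) \<le> l2norm (vsub (s n) y) + l2norm (vsub (s n) x)" for n
  proof -
    have "vsub x y = vsub (vsub (s n) y) (vsub (s n) x)" by (simp add: fun_eq_iff)
    then show ?thesis using l2norm_vsub_le[of "vsub (s n) y" "vsub (s n) x"] s xy by simp
  qed
  ultimately have "l2norm (vsub x y) \<le> 0"
    by (intro LIMSEQ_le_const[where X = "\<lambda>n. l2norm (vsub (s n) y) + l2norm (vsub (s n) x)"]) auto
  then have "l2norm (vsub x y) = 0" using l2norm_nonneg[OF l2_vsub[OF xy]] by linarith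
  then show ?thesis using l2norm_eq_0D[of "vsub x y"] vsub_eq_vzeroD xy by simp
qed

section \<open>Operators\<close>

lemma bounded_opD:
  assumes "bounded_op H K T"
  shows "x \<in> H \<Longrightarrow> T x \<in> K" "x \<in> H \<Longrightarrow> y \<in> H \<Longrightarrow> T (vadd x y) = vadd (T x) (T y)"
    "x \<in> H \<Longrightarrow> T (smul c x) = smul c (T x)"
  using assms by (auto simp: bounded_op_def)

lemma bounded_op_vzero:
  assumes "bounded_op H K T" "vzero \<in> H" shows "T vzero = vzero"
proof -
  have "T (smul 0 vzero) = smul 0 (T vzero)" by (rule bounded_opD(3)[OF assms])
  moreover have "smul 0 x = vzero" for x by (simp add: fun_eq_iff)
  ultimately show ?thesis by simp
qed

lemma bounded_op_zero: "vzero \<in> K \<Longrightarrow> bounded_op H K (\<lambda>x. vzero)"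
  by (auto simp: bounded_op_def fun_eq_iff intro!: exI[of _ 0])

lemma zero_in_commutant:
  assumes "bounded_op H H T" "vzero \<in> H" shows "(\<lambda>x. vzero) \<in> commutant H T"
  using assms bounded_op_vzero[OF assms] by (simp add: commutant_def intertw_def bounded_op_zero)

section \<open>Adjoints and contractions\<close>

lemma is_adjoint_unique:
  assumes H: "lin_subspace H" and S: "is_adjoint H K T S" and S': "is_adjoint H K T S'" and y: "y \<in> K"
  shows "S y = S' y"
proof -
  define z where "z = vsub (S y) (S' y)"
  have m: "S y \<in> H" "S' y \<in> H" "z \<in> H"
    using S S' y H by (auto simp: is_adjoint_def z_def dest: bounded_opD lin_subspaceD)
  then have l: "S y \<in> l2" "S' y \<in> l2" "z \<in> l2" using H lin_subspaceD(1) by blast+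
  have "l2inner z (S y) = l2inner z (S' y)" using S S' y m by (simp add: is_adjoint_def)
  then have "l2inner z z = 0" using l by (subst (2) z_def) (simp add: l2inner_vsub_right)
  then have "z = vzero" using l l2inner_self_eq_0D by blast
  then show ?thesis by (simp add: z_def vsub_eq_vzeroD)
qed

text \<open>\<open>adj\<close> is a \<open>SOME\<close> value, but all adjoints agree on
  \<open>K\<close>, so exhibiting one of them determines it there.\<close>

lemma adj_eqI:
  assumes "lin_subspace H" "is_adjoint H K T S" "y \<in> K"
  shows "adj H K T y = S y"
proof -
  have "is_adjoint H K T (adj H K T)"
    unfolding adj_def by (rule someI[of "is_adjoint H K T", OF assms(2)])
  then show ?thesis using is_adjoint_unique assms by blast
qed

text \<open>From \<open>||S y||^2 = <T (S y), y> \<le> ||S y|| ||y||\<close>. The bound demanded of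
  an adjoint thus comes from \<open>T\<close>, with no estimate of the explicit formula for
  \<open>S\<close>.\<close>

lemma adjoint_contraction:
  assumes H: "lin_subspace H" and T: "contraction H T" and S: "\<And>y. y \<in> H \<Longrightarrow> S y \<in> H"
    and adj: "\<And>x y. x \<in> H \<Longrightarrow> y \<in> H \<Longrightarrow> l2inner (T x) y = l2inner x (S y)" and y: "y \<in> H"
  shows "l2norm (S y) \<le> l2norm y"
proof -
  have m: "S y \<in> H" "T (S y) \<in> H" using T S[OF y]
    by (auto simp: contraction_def bounded_op_def)
  then have l: "S y \<in> l2" "T (S y) \<in> l2" "y \<in> l2" using H y lin_subspaceD(1) by blast+
  have "complex_of_real ((l2norm (S y))\<^sup>2) = l2inner (T (S y)) y"
    using adj[OF m(1) y] l by (simp add: l2inner_self)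
  then have "(l2norm (S y))\<^sup>2 = cmod (l2inner (T (S y)) y)"
    by (metis abs_power2 norm_of_real)
  also have "\<dots> \<le> l2norm (T (S y)) * l2norm y" by (rule l2_Cauchy_Schwarz) (use l in auto)
  also have "\<dots> \<le> l2norm (S y) * l2norm y"
    using assms m l by (intro mult_right_mono) (auto simp: contraction_def)
  finally show ?thesis
    using l by (cases "l2norm (S y) = 0") (auto simp: power2_eq_square order_less_le)
qed

lemma funpow_contraction:
  assumes "contraction H T" "x \<in> H"
  shows "(T ^^ n) x \<in> H" and "l2norm ((T ^^ n) x) \<le> l2norm x"
proof -
  show *: "(T ^^ n) x \<in> H" for n
    using assms by (induction n) (auto simp: contraction_def dest: bounded_opD)
  show "l2norm ((T ^^ n) x) \<le> l2norm x"
    by (induction n) (use assms * in \<open>auto simp: contraction_def intro: order_trans\<close>)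
qed

section \<open>Positive operators and uniqueness of the square root\<close>

lemma positive_op_kernel_square:
  assumes S: "bounded_op l2 l2 S" and pos: "\<And>x. x \<in> l2 \<Longrightarrow> 0 \<le> Re (l2inner (S x) x)"
    and e: "e \<in> l2" and SS: "S (S e) = vzero"
  shows "S e = vzero"
proof -
  define y where "y = S e"
  have y: "y \<in> l2" using e by (simp add: y_def bounded_opD[OF S])
  \<comment> \<open>Positivity is tested on \<open>e + t y\<close>, which \<open>S\<close> maps to
    \<open>y\<close>. An affine function of \<open>t\<close> that is nonnegative on the whole line
    has slope zero, and the slope is \<open>||y||^2\<close>; otherwise the \<open>t\<close> inserted
    below gives the value -1.\<close>
  have *: "0 \<le> Re (l2inner y e) + t * (l2norm y)\<^sup>2" for t :: real
  proof -
    have "S (vadd e (smul (of_real t) y)) = y"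
      using e y SS by (simp add: bounded_opD[OF S]) (simp add: y_def fun_eq_iff)
    then show ?thesis using pos[of "vadd e (smul (of_real t) y)"] e y
      by (simp add: l2inner_linear l2inner_self)
  qed
  have "l2norm y = 0"
  proof (rule ccontr)
    assume "l2norm y \<noteq> 0"
    then show False
      using *[of "- (1 + Re (l2inner y e)) / (l2norm y)\<^sup>2"] by (simp add: field_simps)
  qed
  then show ?thesis using y l2norm_eq_0D y_def by blast
qed

lemma positive_sqrt_eigenvector:
  assumes S: "bounded_op l2 l2 S" and pos: "\<And>x. x \<in> l2 \<Longrightarrow> 0 \<le> Re (l2inner (S x) x)"
    and e: "e \<in> l2" and SS: "S (S e) = smul (of_real (c\<^sup>2)) e" and c: "0 \<le> c"
  shows "S e = smul (of_real c) e"
proof (cases "c = 0")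
  \<comment> \<open>The eigenvalue \<open>- c\<close> of the vector \<open>y\<close> in the other
    case contradicts positivity only for \<open>c > 0\<close>; for \<open>c = 0\<close> the kernel
    argument takes its place.\<close>
  case True
  then have "S (S e) = vzero" using SS by (simp add: fun_eq_iff)
  then have "S e = vzero" using positive_op_kernel_square[OF S pos e] by blast
  then show ?thesis using True by (simp add: fun_eq_iff)
next
  case False
  define y where "y = vadd (S e) (smul (of_real (- c)) e)"
  have y: "y \<in> l2" using e by (simp add: y_def bounded_opD[OF S])
  have "S y = smul (of_real (- c)) y"
    using e SS by (simp add: y_def bounded_opD[OF S])
      (simp add: fun_eq_iff power2_eq_square algebra_simps)
  then have "0 \<le> - (c * (l2norm y)\<^sup>2)" using pos[OF y] y by (simp add: l2inner_linear l2inner_self)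
  moreover have "c > 0" using c False by simp
  ultimately have "(l2norm y)\<^sup>2 \<le> 0" by (simp add: mult_le_0_iff)
  then have "y = vzero" using y by (simp add: l2norm_eq_0D)
  then show ?thesis by (simp add: y_def fun_eq_iff)
qed

text \<open>Polarization: the form being real at \<open>x + y\<close> compares the imaginary parts
  of the two inner products, and at \<open>x + \<i> y\<close> the real parts.\<close>

lemma real_form_selfadjoint:
  assumes S: "bounded_op l2 l2 S" and im: "\<And>x. x \<in> l2 \<Longrightarrow> Im (l2inner (S x) x) = 0"
    and x: "x \<in> l2" and y: "y \<in> l2"
  shows "l2inner (S x) y = l2inner x (S y)"
proof -
  have m: "S x \<in> l2" "S y \<in> l2" using S x y by (auto dest: bounded_opD)
  have 1: "Im (l2inner (S x) y + l2inner (S y) x) = 0"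
    using im[of "vadd x y"] im[OF x] im[OF y] x y m by (simp add: bounded_opD[OF S] l2inner_linear)
  have 2: "Re (l2inner (S y) x - l2inner (S x) y) = 0"
    using im[of "vadd x (smul \<i> y)"] im[OF x] im[OF y] x y m by (simp add: bounded_opD[OF S] l2inner_linear)
  have "l2inner x (S y) = cnj (l2inner (S y) x)" using l2inner_commute m x by blast
  then show ?thesis using 1 2 by (simp add: complex_eq_iff)
qed

definition unit_vec :: "nat \<Rightarrow> vec" where
  "unit_vec i = (\<lambda>k. if k = i then 1 else 0)"

lemma l2_finite_support: "finite {k. x k \<noteq> 0} \<Longrightarrow> x \<in> l2"
  unfolding l2_iff by (rule summable_finite[of "{k. x k \<noteq> 0}"]) auto

lemma unit_vec_in_l2 [simp]: "unit_vec i \<in> l2"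
  by (rule l2_finite_support) (simp add: unit_vec_def)

lemma l2inner_unit_vec [simp]: "l2inner x (unit_vec i) = x i"
proof -
  have "(\<lambda>k. x k * cnj (unit_vec i k)) = (\<lambda>k. if k = i then x k else 0)"
    by (simp add: unit_vec_def fun_eq_iff)
  then show ?thesis using sums_single[of i x] by (simp add: l2inner_def sums_iff)
qed

text \<open>Every positive square root \<open>S\<close> of a diagonal operator is diagonal: from
  \<open>(S + c)(S - c) e = 0\<close> and positivity of \<open>S\<close>, each unit vector is an eigenvector of \<open>S\<close>.\<close>

lemma sqrt_op_diagonal:
  fixes d :: "nat \<Rightarrow> real"
  assumes d: "\<And>i. 0 \<le> d i" "\<And>i. d i \<le> 1"
    and A: "\<And>x. x \<in> l2 \<Longrightarrow> A x = (\<lambda>i. of_real ((d i)\<^sup>2) * x i)"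
    and x: "x \<in> l2"
  shows "sqrt_op l2 A x = (\<lambda>i. of_real (d i) * x i)"
proof -
  let ?P = "\<lambda>S. bounded_op l2 l2 S
      \<and> (\<forall>x\<in>l2. Im (l2inner (S x) x) = 0 \<and> Re (l2inner (S x) x) \<ge> 0)
      \<and> (\<forall>x\<in>l2. S (S x) = A x) \<and> (\<forall>x. x \<notin> l2 \<longrightarrow> S x = vzero)"
  define X where "X x = (if x \<in> l2 then (\<lambda>i. of_real (d i) * x i) else vzero)" for x :: vec
  have le: "cmod (of_real (d i) * x i) \<le> 1 * cmod (x i)" for x :: vec and i
    using d[of i] by (simp add: norm_mult mult_left_le_one_le)
  have Xl2: "X x \<in> l2" "l2norm (X x) \<le> 1 * l2norm x" if "x \<in> l2" for x
    using l2_dominated[of x "X x" 1] that le by (auto simp: X_def)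
  have "?P X"
  proof (intro conjI ballI allI impI)
    show "bounded_op l2 l2 X"
      unfolding bounded_op_def using Xl2
      by (auto simp: X_def fun_eq_iff algebra_simps intro!: exI[of _ 1])
    fix x assume x: "x \<in> l2"
    have "(\<lambda>k. complex_of_real (d k * (cmod (x k))\<^sup>2)) = (\<lambda>k. X x k * cnj (x k))"
      using x by (simp add: X_def fun_eq_iff complex_norm_square[symmetric] mult.assoc)
    moreover have "summable (\<lambda>k. d k * (cmod (x k))\<^sup>2)"
      by (rule summable_comparison_test'[of "\<lambda>k. (cmod (x k))\<^sup>2" 0])
        (use x d in \<open>auto simp: l2_iff mult_left_le_one_le\<close>)
    ultimately have "l2inner (X x) x = of_real (\<Sum>k. d k * (cmod (x k))\<^sup>2)"
      unfolding l2inner_def by (metis suminf_of_real)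
    moreover have "0 \<le> (\<Sum>k. d k * (cmod (x k))\<^sup>2)"
      by (rule suminf_nonneg) (use \<open>summable _\<close> d in auto)
    ultimately show "Im (l2inner (X x) x) = 0" "0 \<le> Re (l2inner (X x) x)" by simp_all
    show "X (X x) = A x" using x Xl2[OF x] A[OF x] by (simp add: X_def fun_eq_iff power2_eq_square)
  qed (simp add: X_def)
  moreover have "S = X" if S: "?P S" for S
  proof
    fix x
    show "S x = X x"
    proof (cases "x \<in> l2")
      case x: True
      have "S (unit_vec i) = smul (of_real (d i)) (unit_vec i)" for i
      proof (rule positive_sqrt_eigenvector)
        show "S (S (unit_vec i)) = smul (of_real ((d i)\<^sup>2)) (unit_vec i)"
          using S A[OF unit_vec_in_l2[of i]] by (simp add: fun_eq_iff) (simp add: unit_vec_def)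
      qed (use S d in auto)
      \<comment> \<open>Moving \<open>S\<close> onto the unit vector, an eigenvector, reads off
        coordinate \<open>i\<close> of \<open>S x\<close>.\<close>
      moreover have "l2inner (S x) (unit_vec i) = l2inner x (S (unit_vec i))" for i
        by (rule real_form_selfadjoint) (use S x in auto)
      ultimately have "S x i = d i * x i" for i
        using x by (simp add: l2inner_linear)
      then show ?thesis using x by (simp add: X_def fun_eq_iff)
    qed (use S in \<open>simp add: X_def\<close>)
  qed
  ultimately have "sqrt_op l2 A = X"
    unfolding sqrt_op_def by (intro the_equality) blast+
  then show ?thesis using x by (simp add: X_def)
qed

section \<open>Splitting the index set into three copies of the naturals\<close>

text \<open>Residues mod 3 realize an orthogonal sum of three copies of \<open>l2\<close> inside the
  one sequence space: one copy for \<open>e_k\<close> with \<open>k \<ge> 0\<close>, one for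
  \<open>k < 0\<close>, one for the \<open>f_j\<close>.\<close>

definition pA :: "vec \<Rightarrow> vec" where "pA x = (\<lambda>n. x (3 * n))"
definition pB :: "vec \<Rightarrow> vec" where "pB x = (\<lambda>n. x (3 * n + 1))"
definition pC :: "vec \<Rightarrow> vec" where "pC x = (\<lambda>n. x (3 * n + 2))"

definition mk3 :: "vec \<Rightarrow> vec \<Rightarrow> vec \<Rightarrow> vec" where
  "mk3 a b c = (\<lambda>i. if i mod 3 = 0 then a (i div 3) else if i mod 3 = 1 then b (i div 3) else c (i div 3))"

lemma parts_mk3 [simp]: "pA (mk3 a b c) = a" "pB (mk3 a b c) = b" "pC (mk3 a b c) = c"
  by (auto simp: pA_def pB_def pC_def mk3_def fun_eq_iff mod_Suc div_Suc)

lemma mk3_parts: "mk3 (pA x) (pB x) (pC x) = x"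
proof
  fix i :: nat
  have "i = 3 * (i div 3) + i mod 3" by simp
  moreover have "i mod 3 = 0 \<or> i mod 3 = 1 \<or> i mod 3 = 2" by linarith
  ultimately consider "i mod 3 = 0" "3 * (i div 3) = i" | "i mod 3 = 1" "3 * (i div 3) + 1 = i"
    | "i mod 3 = 2" "3 * (i div 3) + 2 = i" by (metis add.right_neutral)
  then show "mk3 (pA x) (pB x) (pC x) i = x i"
    by cases (auto simp: mk3_def pA_def pB_def pC_def)
qed

lemma vec_eq_partsI: "pA x = pA y \<Longrightarrow> pB x = pB y \<Longrightarrow> pC x = pC y \<Longrightarrow> x = y"
  by (metis mk3_parts)

lemma parts_linear [simp]:
  "pA (vadd x y) = vadd (pA x) (pA y)" "pB (vadd x y) = vadd (pB x) (pB y)"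
  "pC (vadd x y) = vadd (pC x) (pC y)" "pA (vsub x y) = vsub (pA x) (pA y)"
  "pB (vsub x y) = vsub (pB x) (pB y)" "pC (vsub x y) = vsub (pC x) (pC y)"
  "pA (smul c x) = smul c (pA x)" "pB (smul c x) = smul c (pB x)" "pC (smul c x) = smul c (pC x)"
  "pA vzero = vzero" "pB vzero = vzero" "pC vzero = vzero"
  by (auto simp: fun_eq_iff pA_def pB_def pC_def)

lemma sums_mod3:
  fixes f :: "nat \<Rightarrow> 'a::real_normed_vector"
  assumes "(\<lambda>n. f (3 * n)) sums s0" "(\<lambda>n. f (3 * n + 1)) sums s1" "(\<lambda>n. f (3 * n + 2)) sums s2"
  shows "f sums (s0 + s1 + s2)"
proof -
  have *: "(\<lambda>i. if i mod 3 = r then f i else 0) sums s"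
    if "(\<lambda>n. f (3 * n + r)) sums s" "r < 3" for r s
  proof -
    have "strict_mono (\<lambda>n. 3 * n + r)" by (rule strict_monoI) simp
    moreover have "(if i mod 3 = r then f i else 0) = 0" if "i \<notin> range (\<lambda>n. 3 * n + r)" for i
    proof -
      have "i = 3 * (i div 3) + i mod 3" by simp
      then have "i mod 3 \<noteq> r" using that by (metis rangeI)
      then show ?thesis by simp
    qed
    ultimately have "(\<lambda>n. if (3 * n + r) mod 3 = r then f (3 * n + r) else 0) sums s
        \<longleftrightarrow> (\<lambda>i. if i mod 3 = r then f i else 0) sums s"
      by (rule sums_mono_reindex)
    then show ?thesis using that by simp
  qed
  have "(\<lambda>i. (if i mod 3 = 0 then f i else 0) + (if i mod 3 = 1 then f i else 0)
      + (if i mod 3 = 2 then f i else 0)) sums (s0 + s1 + s2)"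
    using assms by (intro sums_add *) auto
  moreover have "(\<lambda>i. (if i mod 3 = 0 then f i else 0) + (if i mod 3 = 1 then f i else 0)
      + (if i mod 3 = 2 then f i else 0)) = f"
  proof
    fix i :: nat
    have "i mod 3 = 0 \<or> i mod 3 = 1 \<or> i mod 3 = 2" by linarith
    then show "(if i mod 3 = 0 then f i else 0) + (if i mod 3 = 1 then f i else 0)
      + (if i mod 3 = 2 then f i else 0) = f i" by auto
  qed
  ultimately show ?thesis by simp
qed

lemma l2_reindex:
  assumes "x \<in> l2" "inj g" shows "(\<lambda>n. x (g n)) \<in> l2"
  using summable_reindex[of "\<lambda>k. (cmod (x k))\<^sup>2" g] assms by (simp add: l2_iff comp_def)

lemma l2_parts [simp]:
  assumes "x \<in> l2" shows "pA x \<in> l2" "pB x \<in> l2" "pC x \<in> l2"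
  unfolding pA_def pB_def pC_def by (rule l2_reindex[OF assms], simp add: inj_def)+

lemma l2_mk3 [simp]:
  assumes "a \<in> l2" "b \<in> l2" "c \<in> l2" shows "mk3 a b c \<in> l2"
proof -
  have "(\<lambda>i. (cmod (mk3 a b c i))\<^sup>2) sums
      ((\<Sum>k. (cmod (a k))\<^sup>2) + (\<Sum>k. (cmod (b k))\<^sup>2) + (\<Sum>k. (cmod (c k))\<^sup>2))"
    using assms[unfolded l2_iff, THEN summable_sums]
    by (intro sums_mod3) (simp_all add: mk3_def div_Suc mod_Suc)
  then show ?thesis by (simp add: l2_iff sums_iff)
qed

lemma l2inner_parts:
  assumes "x \<in> l2" "y \<in> l2"
  shows "l2inner x y = l2inner (pA x) (pA y) + l2inner (pB x) (pB y) + l2inner (pC x) (pC y)"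
proof -
  have "(\<lambda>k. x k * cnj (y k)) sums
      (l2inner (pA x) (pA y) + l2inner (pB x) (pB y) + l2inner (pC x) (pC y))"
    using l2inner_summable[OF l2_parts(1) l2_parts(1), OF assms, THEN summable_sums]
      l2inner_summable[OF l2_parts(2) l2_parts(2), OF assms, THEN summable_sums]
      l2inner_summable[OF l2_parts(3) l2_parts(3), OF assms, THEN summable_sums]
    unfolding l2inner_def pA_def pB_def pC_def by (intro sums_mod3)
  then show ?thesis by (simp add: l2inner_def sums_iff)
qed

lemma l2norm_parts:
  assumes "x \<in> l2"
  shows "(l2norm x)\<^sup>2 = (l2norm (pA x))\<^sup>2 + (l2norm (pB x))\<^sup>2 + (l2norm (pC x))\<^sup>2"
proof -
  have "complex_of_real ((l2norm x)\<^sup>2)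
      = of_real ((l2norm (pA x))\<^sup>2 + (l2norm (pB x))\<^sup>2 + (l2norm (pC x))\<^sup>2)"
    using l2inner_parts[OF assms assms] assms by (simp add: l2inner_self)
  then show ?thesis using of_real_eq_iff by blast
qed

section \<open>Prepending and deleting a first coordinate\<close>

lemma l2_tail [simp]: "x \<in> l2 \<Longrightarrow> (\<lambda>n. x (Suc n)) \<in> l2"
  by (rule l2_reindex) simp_all

lemma l2_case_nat [simp]: "a \<in> l2 \<Longrightarrow> case_nat z a \<in> l2"
  unfolding l2_iff by (subst summable_Suc_iff[symmetric]) simp

lemma l2inner_case_nat:
  assumes "a \<in> l2" "y \<in> l2"
  shows "l2inner (case_nat z a) y = z * cnj (y 0) + l2inner a (\<lambda>n. y (Suc n))"
  using suminf_split_head[OF l2inner_summable[OF l2_case_nat[OF assms(1), of z] assms(2)]]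
  by (simp add: l2inner_def)

lemma l2norm_split_head:
  assumes "x \<in> l2"
  shows "(l2norm x)\<^sup>2 = (cmod (x 0))\<^sup>2 + (l2norm (\<lambda>n. x (Suc n)))\<^sup>2"
  using suminf_split_head[of "\<lambda>k. (cmod (x k))\<^sup>2"] assms
  by (simp add: l2norm_power2 l2norm_power2[OF l2_tail] l2_iff[symmetric])

lemma l2norm_case_nat:
  "a \<in> l2 \<Longrightarrow> (l2norm (case_nat z a))\<^sup>2 = (cmod z)\<^sup>2 + (l2norm a)\<^sup>2"
  using l2norm_split_head[of "case_nat z a"] by simp

section \<open>The operator\<close>

definition wt :: "nat \<Rightarrow> real" where "wt j = sqrt (real (j + 1) / real (j + 2))"

definition wtprod :: "nat \<Rightarrow> real" where "wtprod j = 1 / sqrt (real (j + 1))"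

text \<open>\<open>geo n\<close> is the coefficient of \<open>f_0\<close> in
  \<open>T e_(-n-1)\<close>, so pairing with \<open>geo\<close> computes the \<open>f_0\<close>
  coordinate of an image under \<open>T\<close>.\<close>

definition geo :: vec where "geo n = (1 / 2) ^ Suc n"

lemma wt_bounds: "0 < wt j" "wt j \<le> 1"
  by (auto simp: wt_def)

lemma wt_power2: "(wt j)\<^sup>2 = real (j + 1) / real (j + 2)"
  by (simp add: wt_def)

lemma wtprod_0 [simp]: "wtprod 0 = 1"
  by (simp add: wtprod_def)

lemma wtprod_Suc: "wtprod (Suc j) = wt j * wtprod j"
  by (simp add: wtprod_def wt_def real_sqrt_divide add.commute)

lemma wtprod_bounds: "0 < wtprod j" "wtprod j \<le> 1"
  by (auto simp: wtprod_def)

lemma wtprod_not_l2: "(\<lambda>j. of_real (wtprod j)) \<notin> l2"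
proof -
  have "(\<lambda>j. (cmod (of_real (wtprod j)))\<^sup>2) = (\<lambda>j. inverse (real (Suc j)))"
    by (simp add: wtprod_def fun_eq_iff norm_divide power_divide inverse_eq_divide add.commute)
  then show ?thesis using not_summable_harmonic[where 'a = real]
      summable_Suc_iff[of "\<lambda>n. inverse (real n)"] by (simp add: l2_iff)
qed

lemma cnj_geo [simp]: "cnj (geo n) = geo n"
  by (simp add: geo_def)

lemma geo_sums: "(\<lambda>n. (cmod (geo n))\<^sup>2) sums (1 / 3)"
proof -
  have "(\<lambda>n. (1 / 4) * (1 / 4) ^ n) sums ((1 / 4) * (1 / (1 - 1 / 4 :: real)))"
    by (intro sums_mult geometric_sums) simp
  moreover have "(cmod (geo n))\<^sup>2 = (1 / 4) * (1 / 4) ^ n" for n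
    by (simp add: geo_def norm_mult norm_power power_mult_distrib power2_eq_square flip: power_mult_distrib)
  ultimately show ?thesis by (simp only: mult_1_right) simp
qed

lemma geo_in_l2 [simp]: "geo \<in> l2"
  using geo_sums by (auto simp: l2_iff sums_iff)

lemma l2norm_geo: "(l2norm geo)\<^sup>2 = 1 / 3"
  using geo_sums by (simp add: l2norm_power2 sums_iff)

lemma l2inner_geo_le: "b \<in> l2 \<Longrightarrow> (cmod (l2inner b geo))\<^sup>2 \<le> (l2norm b)\<^sup>2 / 3"
  using power_mono[OF l2_Cauchy_Schwarz[of b geo], of 2] by (simp add: power_mult_distrib l2norm_geo)

lemma l2_wt [simp]: "c \<in> l2 \<Longrightarrow> (\<lambda>j. of_real (wt j) * c j) \<in> l2"
  and l2norm_wt_le: "c \<in> l2 \<Longrightarrow> l2norm (\<lambda>j. of_real (wt j) * c j) \<le> l2norm c"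
  using l2_dominated[of c "\<lambda>j. of_real (wt j) * c j" 1] wt_bounds
  by (auto simp: norm_mult mult_left_le_one_le less_imp_le)

lemma l2_half [simp]: "b \<in> l2 \<Longrightarrow> (\<lambda>n. b n / 2) \<in> l2"
  using l2_smul[of b "1/2"] by (simp add: smul_def)

lemma l2norm_half: "b \<in> l2 \<Longrightarrow> l2norm (\<lambda>n. b n / 2) = l2norm b / 2"
  using l2norm_smul[of b "1/2"] by (simp add: smul_def)

text \<open>The components \<open>pA x n\<close>, \<open>pB x n\<close>, \<open>pC x n\<close> are the coefficients of \<open>e\<^sub>n\<close>, \<open>e\<^bsub>-n-1\<^esub>\<close> and \<open>f\<^sub>n\<close>.\<close>

definition opT :: op where
  "opT x = mk3 (case_nat (pB x 0 / 2) (pA x)) (\<lambda>n. pB x (Suc n) / 2)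
     (case_nat (l2inner (pB x) geo) (\<lambda>j. of_real (wt j) * pC x j))"

lemma parts_opT [simp]:
  "pA (opT x) = case_nat (pB x 0 / 2) (pA x)"
  "pB (opT x) = (\<lambda>n. pB x (Suc n) / 2)"
  "pC (opT x) = case_nat (l2inner (pB x) geo) (\<lambda>j. of_real (wt j) * pC x j)"
  by (simp_all add: opT_def)

lemma opT_in_l2 [simp]: "x \<in> l2 \<Longrightarrow> opT x \<in> l2"
  by (simp add: opT_def)

text \<open>The \<open>pA\<close> part is carried isometrically and the \<open>pC\<close> part
  contractively. The \<open>pB\<close> part contributes a quarter of its squared norm to the
  \<open>e\<close> coordinates and, by Cauchy-Schwarz with \<open>||geo||^2 = 1/3\<close>, at most a
  third to \<open>f_0\<close>; and \<open>1/4 + 1/3 < 1\<close>.\<close>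

lemma contraction_opT: "contraction l2 opT"
proof -
  have norm: "l2norm (opT x) \<le> l2norm x" if x: "x \<in> l2" for x
  proof (rule power2_le_imp_le)
    have "(l2norm (opT x))\<^sup>2 = (cmod (pB x 0 / 2))\<^sup>2 + (l2norm (pA x))\<^sup>2
        + (l2norm (\<lambda>n. pB x (Suc n) / 2))\<^sup>2
        + ((cmod (l2inner (pB x) geo))\<^sup>2 + (l2norm (\<lambda>j. of_real (wt j) * pC x j))\<^sup>2)"
      using x by (subst l2norm_parts) (simp_all add: l2norm_case_nat)
    also have "(cmod (pB x 0 / 2))\<^sup>2 = (cmod (pB x 0))\<^sup>2 / 4"
      by (simp add: norm_divide power_divide)
    also have "(l2norm (\<lambda>n. pB x (Suc n) / 2))\<^sup>2 = (l2norm (\<lambda>n. pB x (Suc n)))\<^sup>2 / 4"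
      unfolding l2norm_half[OF l2_tail[OF l2_parts(2)[OF x]]] by (simp add: power_divide)
    finally have "(l2norm (opT x))\<^sup>2 = (l2norm (pA x))\<^sup>2 + (l2norm (pB x))\<^sup>2 / 4
        + (cmod (l2inner (pB x) geo))\<^sup>2 + (l2norm (\<lambda>j. of_real (wt j) * pC x j))\<^sup>2"
      using l2norm_split_head[of "pB x"] x by simp
    moreover have "(l2norm (\<lambda>j. of_real (wt j) * pC x j))\<^sup>2 \<le> (l2norm (pC x))\<^sup>2"
      using x by (intro power_mono l2norm_wt_le) auto
    ultimately show "(l2norm (opT x))\<^sup>2 \<le> (l2norm x)\<^sup>2"
      using l2inner_geo_le[OF l2_parts(2)[OF x]] l2norm_parts[OF x] zero_le_power2[of "l2norm (pB x)"]
      by linarith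
  qed (use x in simp)
  have "opT (vadd x y) = vadd (opT x) (opT y)" if "x \<in> l2" "y \<in> l2" for x y
    by (rule vec_eq_partsI) (use that in \<open>auto simp: fun_eq_iff l2inner_linear algebra_simps add_divide_distrib split: nat.split\<close>)
  moreover have "opT (smul c x) = smul c (opT x)" if "x \<in> l2" for c x
    by (rule vec_eq_partsI) (use that in \<open>auto simp: fun_eq_iff l2inner_linear algebra_simps split: nat.split\<close>)
  ultimately show ?thesis
    unfolding contraction_def bounded_op_def using norm by (auto intro!: exI[of _ 1])
qed

lemmas bounded_op_opT = contraction_opT[unfolded contraction_def, THEN conjunct1]

text \<open>The adjoint of \<open>opT\<close>, read off by transposing its matrix: the row that
  feeds \<open>f_0\<close> becomes the column \<open>geo\<close>.\<close>

definition opTs :: op where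
  "opTs y = mk3 (\<lambda>n. pA y (Suc n))
     (vadd (case_nat (pA y 0 / 2) (\<lambda>n. pB y n / 2)) (smul (pC y 0) geo))
     (\<lambda>j. of_real (wt j) * pC y (Suc j))"

lemma parts_opTs [simp]:
  "pA (opTs y) = (\<lambda>n. pA y (Suc n))"
  "pB (opTs y) = vadd (case_nat (pA y 0 / 2) (\<lambda>n. pB y n / 2)) (smul (pC y 0) geo)"
  "pC (opTs y) = (\<lambda>j. of_real (wt j) * pC y (Suc j))"
  by (simp_all add: opTs_def)

lemma opTs_in_l2 [simp]: "y \<in> l2 \<Longrightarrow> opTs y \<in> l2"
  using l2_wt[OF l2_tail[of "pC y"]] by (simp add: opTs_def)

lemma l2inner_wt: "l2inner (\<lambda>j. of_real (wt j) * c j) y = l2inner c (\<lambda>j. of_real (wt j) * y j)"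
  by (simp add: l2inner_def mult_ac)

lemma l2inner_opT:
  assumes x: "x \<in> l2" and y: "y \<in> l2" shows "l2inner (opT x) y = l2inner x (opTs y)"
proof -
  have B: "pB x = case_nat (pB x 0) (\<lambda>n. pB x (Suc n))" by (simp add: fun_eq_iff split: nat.split)
  have "l2inner (pB x) (case_nat (pA y 0 / 2) (\<lambda>n. pB y n / 2))
      = pB x 0 * cnj (pA y 0 / 2) + l2inner (\<lambda>n. pB x (Suc n)) (\<lambda>n. pB y n / 2)"
    using x y by (subst B, subst l2inner_case_nat) auto
  also have "l2inner (\<lambda>n. pB x (Suc n)) (\<lambda>n. pB y n / 2) = l2inner (\<lambda>n. pB x (Suc n) / 2) (pB y)"
    by (simp add: l2inner_def)
  finally show ?thesis
    using x y l2_wt[OF l2_tail[of "pC y"]]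
    unfolding l2inner_parts[OF opT_in_l2[OF x] y] l2inner_parts[OF x opTs_in_l2[OF y]]
    by (simp add: l2inner_case_nat l2inner_linear l2inner_wt)
qed

lemma l2norm_opTs_le: "y \<in> l2 \<Longrightarrow> l2norm (opTs y) \<le> l2norm y"
  by (rule adjoint_contraction[OF lin_subspace_l2 contraction_opT]) (simp_all add: l2inner_opT)

lemma opTs_linear:
  "opTs (vadd x y) = vadd (opTs x) (opTs y)" "opTs (smul c x) = smul c (opTs x)"
  by (rule vec_eq_partsI; auto simp: fun_eq_iff algebra_simps add_divide_distrib split: nat.split)+

lemma contraction_opTs: "contraction l2 opTs"
  unfolding contraction_def bounded_op_def using l2norm_opTs_le
  by (auto simp: opTs_linear intro!: exI[of _ 1])

lemma adj_opT: "y \<in> l2 \<Longrightarrow> adj l2 l2 opT y = opTs y"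
  using contraction_opTs
  by (intro adj_eqI[OF lin_subspace_l2]) (simp_all add: lin_subspace_l2 is_adjoint_def contraction_def l2inner_opT)

section \<open>The asymptotic limit and its square root\<close>

definition compC :: "vec set" where "compC = {x \<in> l2. pA x = vzero \<and> pB x = vzero}"
definition compAB :: "vec set" where "compAB = {x \<in> l2. pC x = vzero}"

lemma compC_l2: "x \<in> compC \<Longrightarrow> x \<in> l2" and compAB_l2: "x \<in> compAB \<Longrightarrow> x \<in> l2"
  by (auto simp: compC_def compAB_def)

lemma lin_subspace_compC: "lin_subspace compC"
  by (auto simp: lin_subspace_def compC_def fun_eq_iff)

lemma vzero_case_nat [simp]: "case_nat 0 vzero = vzero"
  by (simp add: fun_eq_iff split: nat.split)

lemma vzero_scale [simp]: "(\<lambda>n. c n * vzero n) = vzero" "(\<lambda>n. vzero (Suc n) / 2) = vzero"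
  by (simp_all add: fun_eq_iff)

lemma opT_compC: "x \<in> compC \<Longrightarrow> opT x \<in> compC"
  unfolding compC_def by (auto simp del: vec_apply) (simp_all add: fun_eq_iff split: nat.split)

lemma l2norm_compC: "x \<in> compC \<Longrightarrow> l2norm x = l2norm (pC x)"
  using l2norm_parts[of x] by (auto simp: compC_def)

text \<open>\<open>n\<close> steps multiply \<open>f_j\<close> by
  \<open>wtprod (j + n) / wtprod j\<close>, whose square is
  \<open>(j + 1) / (j + n + 1)\<close>.\<close>

lemma l2norm_opT_pow_compC:
  assumes "x \<in> compC"
  shows "(l2norm ((opT ^^ n) x))\<^sup>2 = (\<Sum>j. real (j + 1) / real (j + n + 1) * (cmod (pC x j))\<^sup>2)"
  using assms
proof (induction n arbitrary: x)
  case 0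
  then have "(l2norm x)\<^sup>2 = (\<Sum>j. (cmod (pC x j))\<^sup>2)"
    using l2norm_compC l2norm_power2[of "pC x"] by (simp add: compC_l2)
  then show ?case by simp
next
  case (Suc n)
  let ?f = "\<lambda>j. real (j + 1) / real (j + n + 1) * (cmod (pC (opT x) j))\<^sup>2"
  have Tx: "opT x \<in> compC" "opT x \<in> l2" using opT_compC Suc.prems compC_l2 by auto
  have "summable ?f"
  proof (rule summable_comparison_test'[of "\<lambda>j. (cmod (pC (opT x) j))\<^sup>2" 0])
    show "summable (\<lambda>j. (cmod (pC (opT x) j))\<^sup>2)"
      using l2_parts(3)[OF Tx(2)] by (simp only: l2_iff)
    show "norm (?f j) \<le> (cmod (pC (opT x) j))\<^sup>2" for j
      unfolding real_norm_def abs_mult by (rule order_trans[OF mult_left_le_one_le]) auto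
  qed
  then have "suminf ?f = (\<Sum>j. ?f (Suc j)) + ?f 0" by (subst suminf_split_head) simp_all
  \<comment> \<open>The image has coordinate 0 equal to zero. After the index shift the numerator
    \<open>j + 2\<close> cancels against the denominator of \<open>(wt j)^2\<close>.\<close>
  also have "?f 0 = 0" using Suc.prems by (simp add: compC_def)
  also have "(\<lambda>j. ?f (Suc j)) = (\<lambda>j. real (j + 1) / real (j + Suc n + 1) * (cmod (pC x j))\<^sup>2)"
    by (simp add: fun_eq_iff norm_mult power_mult_distrib wt_power2 divide_simps)
  finally have "suminf ?f = (\<Sum>j. real (j + 1) / real (j + Suc n + 1) * (cmod (pC x j))\<^sup>2)"
    by simp
  moreover have "(l2norm ((opT ^^ Suc n) x))\<^sup>2 = suminf ?f"
    unfolding funpow_Suc_right comp_def using Suc.IH[OF Tx(1)] by simp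
  ultimately show ?case by simp
qed

text \<open>Every term of the preceding series tends to 0 and is dominated by
  \<open>(cmod (pC x j))^2\<close>, so limit and sum may be exchanged by Tannery's theorem.\<close>

lemma opT_pow_compC_tendsto_0:
  assumes "x \<in> compC" shows "(\<lambda>n. l2norm ((opT ^^ n) x)) \<longlonglongrightarrow> 0"
proof -
  have s: "summable (\<lambda>j. (cmod (pC x j))\<^sup>2)"
    using l2_parts(3)[OF compC_l2[OF assms]] by (simp only: l2_iff)
  have lim: "(\<lambda>n. real (j + 1) / real (j + n + 1) * (cmod (pC x j))\<^sup>2) \<longlonglongrightarrow> 0" for j
  proof -
    have "filterlim (\<lambda>n. real (j + n + 1)) at_top sequentially"
      by (rule filterlim_compose[OF filterlim_real_sequentially])
        (auto intro!: filterlim_subseq simp: strict_mono_def)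
    then have "(\<lambda>n. real (j + 1) / real (j + n + 1)) \<longlonglongrightarrow> 0"
      by (rule tendsto_divide_0[OF tendsto_const filterlim_at_top_imp_at_infinity])
    then show ?thesis by (rule tendsto_mult_left_zero)
  qed
  have bd: "norm (real (j + 1) / real (j + n + 1) * (cmod (pC x j))\<^sup>2) \<le> (cmod (pC x j))\<^sup>2" for j n
    unfolding real_norm_def abs_mult by (rule order_trans[OF mult_left_le_one_le]) auto
  have "(\<lambda>n. \<Sum>j. real (j + 1) / real (j + n + 1) * (cmod (pC x j))\<^sup>2) \<longlonglongrightarrow> (\<Sum>j. 0)"
    using tannerys_theorem[OF lim _ s] bd by (simp add: case_prod_unfold)
  then have "(\<lambda>n. (l2norm ((opT ^^ n) x))\<^sup>2) \<longlonglongrightarrow> 0"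
    unfolding l2norm_opT_pow_compC[OF assms] by simp
  then have "(\<lambda>n. sqrt ((l2norm ((opT ^^ n) x))\<^sup>2)) \<longlonglongrightarrow> 0"
    using tendsto_real_sqrt by fastforce
  then show ?thesis
    using funpow_contraction(1)[OF contraction_opT compC_l2[OF assms]] by simp
qed

text \<open>The limits of \<open>||T^m v||\<close> over the basis vectors \<open>v\<close>:
  \<open>e_n\<close> with \<open>n \<ge> 0\<close> moves isometrically, \<open>e_(-n-1)\<close>
  loses \<open>n + 1\<close> factors \<open>1/2\<close> before reaching \<open>e_0\<close>, and
  every \<open>f_j\<close> dies out. This is the diagonal of the square root of
  \<open>A_T\<close>.\<close>

definition diagA :: "nat \<Rightarrow> real" where
  "diagA i = (if i mod 3 = 0 then 1 else if i mod 3 = 1 then (1 / 2) ^ Suc (i div 3) else 0)"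

definition opA :: op where "opA x = (\<lambda>i. of_real ((diagA i)\<^sup>2) * x i)"

lemma diagA_bounds: "0 \<le> diagA i" "diagA i \<le> 1"
  unfolding diagA_def by (auto simp: power_le_one simp del: power_Suc)

lemma parts_opA [simp]:
  "pA (opA x) = pA x" "pB (opA x) = (\<lambda>n. (1 / 4) ^ Suc n * pB x n)" "pC (opA x) = vzero"
proof -
  have "((1 / 2) ^ Suc n)\<^sup>2 = ((1 / 4) ^ Suc n :: complex)" for n
    by (simp add: power2_eq_square del: power_Suc flip: power_mult_distrib)
  then show "pB (opA x) = (\<lambda>n. (1 / 4) ^ Suc n * pB x n)"
    by (simp add: pB_def opA_def diagA_def fun_eq_iff mod_Suc div_Suc del: power_Suc)
qed (auto simp: pA_def pC_def opA_def diagA_def fun_eq_iff mod_Suc)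

lemma opA_in_l2 [simp]: "x \<in> l2 \<Longrightarrow> opA x \<in> l2"
  by (rule l2_dominated(1)[where y = x and B = 1])
    (auto simp: opA_def norm_mult norm_power power_le_one diagA_bounds mult_left_le_one_le)

text \<open>Iterating this fixed-point equation, the distance of the \<open>n\<close>-th approximant
  of \<open>A_T\<close> from \<open>opA x\<close> is that of the \<open>n\<close>-th adjoint power
  applied to \<open>defectA (T^n x)\<close>. Convergence to \<open>opA\<close> thereby reduces to
  \<open>defectA (T^n x)\<close> tending to 0.\<close>

lemma opTs_opA_opT: "opTs (opA (opT x)) = opA x"
  by (rule vec_eq_partsI) (auto simp: fun_eq_iff split: nat.split)

lemma opTs_pow_opA_opT_pow: "(opTs ^^ n) (opA ((opT ^^ n) x)) = opA x"
proof (induction n)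
  case (Suc n)
  have "(opTs ^^ Suc n) (opA ((opT ^^ Suc n) x)) = (opTs ^^ n) (opTs (opA (opT ((opT ^^ n) x))))"
    unfolding funpow_Suc_right[of n opTs] by simp
  then show ?case using Suc by (simp add: opTs_opA_opT)
qed simp

abbreviation defectA :: op where "defectA x \<equiv> vsub x (opA x)"

lemma l2norm_defectA_le: "x \<in> l2 \<Longrightarrow> l2norm (defectA x) \<le> l2norm x"
proof -
  assume x: "x \<in> l2"
  have "cmod (defectA x i) \<le> 1 * cmod (x i)" for i
  proof -
    have "defectA x i = of_real (1 - (diagA i)\<^sup>2) * x i"
      by (simp add: opA_def algebra_simps)
    moreover have "\<bar>1 - (diagA i)\<^sup>2\<bar> \<le> 1" using diagA_bounds[of i] by (simp add: abs_le_iff power_le_one)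
    ultimately show ?thesis by (simp only: norm_mult norm_of_real mult_right_mono norm_ge_zero)
  qed
  then show ?thesis using l2_dominated(2)[OF x, of "defectA x" 1] by simp
qed

lemma opA_linear: "opA (vadd x y) = vadd (opA x) (opA y)"
  by (simp add: opA_def fun_eq_iff algebra_simps)

lemma l2norm_defectA_vadd:
  assumes "x \<in> l2" "y \<in> l2"
  shows "l2norm (defectA (vadd x y)) \<le> l2norm (defectA x) + l2norm (defectA y)"
proof -
  have "defectA (vadd x y) = vadd (defectA x) (defectA y)" by (simp add: opA_linear fun_eq_iff)
  then show ?thesis using l2norm_triangle[of "defectA x" "defectA y"] assms by simp
qed

lemma opT_pow_in_l2 [simp]: "x \<in> l2 \<Longrightarrow> (opT ^^ n) x \<in> l2"
  by (rule funpow_contraction(1)[OF contraction_opT])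

lemma opT_pow_vadd:
  "x \<in> l2 \<Longrightarrow> y \<in> l2 \<Longrightarrow> (opT ^^ n) (vadd x y) = vadd ((opT ^^ n) x) ((opT ^^ n) y)"
  by (induction n) (auto simp: bounded_opD[OF bounded_op_opT])

lemma defectA_opT_pow_pA:
  assumes "pB x = vzero" "pC x = vzero" shows "defectA ((opT ^^ n) x) = vzero"
proof -
  have *: "pB ((opT ^^ n) x) = vzero \<and> pC ((opT ^^ n) x) = vzero"
    by (induction n) (simp_all add: assms del: vec_apply)
  show ?thesis by (rule vec_eq_partsI) (use * in \<open>auto simp: fun_eq_iff\<close>)
qed

lemma l2norm_pB_opT_pow:
  assumes "x \<in> l2" shows "l2norm (pB ((opT ^^ n) x)) \<le> (1 / 2) ^ n * l2norm (pB x)"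
proof (induction n)
  case (Suc n)
  let ?b = "pB ((opT ^^ n) x)"
  have b: "?b \<in> l2" using assms by simp
  have "l2norm (\<lambda>k. ?b (Suc k)) \<le> l2norm ?b"
    by (rule power2_le_imp_le) (use l2norm_split_head[OF b] b in auto)
  then have "l2norm (\<lambda>k. ?b (Suc k) / 2) \<le> l2norm ?b / 2"
    using l2norm_half[OF l2_tail[OF b]] by simp
  then show ?case using Suc by simp
qed simp

text \<open>Run \<open>m\<close> steps until the \<open>pB\<close> part is below
  \<open>r / 2\<close>, then split. The part in \<open>e_k\<close>, \<open>k \<ge> 0\<close>, never
  has a defect; the \<open>pB\<close> part stays below \<open>r / 2\<close>, both \<open>T\<close>
  and \<open>defectA\<close> being contractive; the \<open>f\<close> part tends to 0 under further
  powers.\<close>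

lemma defectA_opT_pow_tendsto_0:
  assumes x: "x \<in> l2" shows "(\<lambda>n. l2norm (defectA ((opT ^^ n) x))) \<longlonglongrightarrow> 0"
proof (rule LIMSEQ_I)
  fix r :: real assume r: "0 < r"
  have "(\<lambda>m. (1 / 2) ^ m * l2norm (pB x)) \<longlonglongrightarrow> 0"
    by (intro tendsto_mult_left_zero LIMSEQ_power_zero) simp
  from order_tendstoD(2)[OF this, of "r / 2"]
  obtain m where m: "(1 / 2) ^ m * l2norm (pB x) < r / 2"
    using r unfolding eventually_sequentially by auto
  define y where "y = (opT ^^ m) x"
  define a where "a = mk3 (pA y) vzero vzero"
  define b where "b = mk3 vzero (pB y) vzero"
  define c where "c = mk3 vzero vzero (pC y)"
  have y: "y \<in> l2" using x by (simp add: y_def)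
  have l: "a \<in> l2" "b \<in> l2" "c \<in> l2" "c \<in> compC" using y by (auto simp: a_def b_def c_def compC_def)
  have yabc: "y = vadd (vadd a b) c"
    by (rule vec_eq_partsI) (auto simp: a_def b_def c_def fun_eq_iff)
  have nb: "l2norm b < r / 2"
  proof -
    have "l2norm b = l2norm (pB y)"
      using l2norm_parts[OF l(2)] y by (simp add: b_def power2_eq_iff_nonneg)
    then show ?thesis using l2norm_pB_opT_pow[OF x, of m] m by (simp add: y_def)
  qed
  \<comment> \<open>\<open>c\<close> depends on \<open>m\<close>, so \<open>N\<close> can only be
    chosen after \<open>m\<close>.\<close>
  obtain N where N: "\<And>n. n \<ge> N \<Longrightarrow> l2norm ((opT ^^ n) c) < r / 2"
    using order_tendstoD(2)[OF opT_pow_compC_tendsto_0[OF l(4)], of "r / 2"] r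
    unfolding eventually_sequentially by auto
  have "l2norm (defectA ((opT ^^ n) x)) < r" if "n \<ge> N + m" for n
  proof -
    define k where "k = n - m"
    have k: "n = k + m" "k \<ge> N" using that by (simp_all add: k_def)
    have "(opT ^^ n) x = (opT ^^ k) y" by (simp add: k(1) funpow_add y_def)
    also have "\<dots> = vadd (vadd ((opT ^^ k) a) ((opT ^^ k) b)) ((opT ^^ k) c)"
      using l by (simp add: yabc opT_pow_vadd)
    finally have "l2norm (defectA ((opT ^^ n) x)) \<le> l2norm (defectA ((opT ^^ k) a))
        + l2norm (defectA ((opT ^^ k) b)) + l2norm (defectA ((opT ^^ k) c))"
      using l2norm_defectA_vadd[of "vadd ((opT ^^ k) a) ((opT ^^ k) b)" "(opT ^^ k) c"]
        l2norm_defectA_vadd[of "(opT ^^ k) a" "(opT ^^ k) b"] l by simp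
    moreover have "defectA ((opT ^^ k) a) = vzero"
      by (rule defectA_opT_pow_pA) (simp_all add: a_def)
    moreover have "l2norm (defectA ((opT ^^ k) b)) \<le> l2norm b"
      using l2norm_defectA_le[of "(opT ^^ k) b"] funpow_contraction(2)[OF contraction_opT l(2), of k] l by simp
    moreover have "l2norm (defectA ((opT ^^ k) c)) \<le> l2norm ((opT ^^ k) c)"
      using l by (intro l2norm_defectA_le) simp
    ultimately show ?thesis using nb N[OF k(2)] by simp
  qed
  then show "\<exists>no. \<forall>n\<ge>no. norm (l2norm (defectA ((opT ^^ n) x)) - 0) < r"
    using x by (intro exI[of _ "N + m"]) auto
qed

lemma adj_opT_pow: "y \<in> l2 \<Longrightarrow> (adj l2 l2 opT ^^ n) y = (opTs ^^ n) y"
  using funpow_contraction(1)[OF contraction_opTs] by (induction n) (auto simp: adj_opT)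

lemma opTs_pow_vsub: "(opTs ^^ n) (vsub x y) = vsub ((opTs ^^ n) x) ((opTs ^^ n) y)"
  by (induction n) (simp_all add: vsub_eq opTs_linear del: vec_apply)

lemma A_T_opT:
  assumes x: "x \<in> l2" shows "A_T l2 opT x = opA x"
proof -
  let ?s = "\<lambda>n. (adj l2 l2 opT ^^ n) ((opT ^^ n) x)"
  have s: "?s n = (opTs ^^ n) ((opT ^^ n) x)" for n using x by (simp add: adj_opT_pow)
  then have sl2: "?s n \<in> l2" for n
    using funpow_contraction(1)[OF contraction_opTs] x by simp
  have "l2norm (vsub (?s n) (opA x)) \<le> l2norm (defectA ((opT ^^ n) x))" for n
  proof -
    have "vsub (?s n) (opA x) = (opTs ^^ n) (defectA ((opT ^^ n) x))"
      by (simp add: s opTs_pow_vsub opTs_pow_opA_opT_pow)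
    then show ?thesis using funpow_contraction(2)[OF contraction_opTs] x by simp
  qed
  then have "(\<lambda>n. l2norm (vsub (?s n) (opA x))) \<longlonglongrightarrow> 0"
    using sl2 x by (intro tendsto_sandwich[OF _ _ tendsto_const defectA_opT_pow_tendsto_0[OF x]]) auto
  then have "l2conv ?s (opA x)" using x by (simp add: l2conv_def)
  then show ?thesis unfolding A_T_def
    using l2conv_unique[of ?s, OF sl2] by (intro the_equality) blast+
qed

lemma X_T_opT: "x \<in> l2 \<Longrightarrow> X_T l2 opT x = (\<lambda>i. of_real (diagA i) * x i)"
  unfolding X_T_def by (rule sqrt_op_diagonal) (auto simp: diagA_bounds A_T_opT opA_def)

lemma X_T_compC: "x \<in> compC \<Longrightarrow> X_T l2 opT x = vzero"
proof -
  assume x: "x \<in> compC"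
  have "pA x = vzero" "pB x = vzero" using x by (auto simp: compC_def)
  then show ?thesis using x
    by (intro vec_eq_partsI[of "X_T l2 opT x"]) (auto simp: X_T_opT compC_l2 fun_eq_iff pA_def pB_def pC_def diagA_def mod_Suc)
qed

text \<open>Since \<open>opA x\<close> is the image of \<open>opA (T^n x)\<close> under a
  contraction, \<open>||opA x|| \<le> ||T^n x||\<close>. A stable vector is therefore killed by
  \<open>opA\<close>, which has nonzero diagonal entries at every \<open>e_k\<close>.\<close>

lemma stable_sub_opT: "stable_sub l2 opT = compC"
proof (intro equalityI subsetI)
  fix x assume x: "x \<in> stable_sub l2 opT"
  then have xl: "x \<in> l2" and lim: "(\<lambda>n. l2norm ((opT ^^ n) x)) \<longlonglongrightarrow> 0" by (auto simp: stable_sub_def)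
  have "l2norm (opA x) \<le> l2norm ((opT ^^ n) x)" for n
  proof -
    have "l2norm (opA x) \<le> l2norm (opA ((opT ^^ n) x))"
      using funpow_contraction(2)[OF contraction_opTs, of "opA ((opT ^^ n) x)" n] xl
      by (simp add: opTs_pow_opA_opT_pow)
    also have "\<dots> \<le> 1 * l2norm ((opT ^^ n) x)"
      by (rule l2_dominated(2)) (use xl in \<open>auto simp: opA_def norm_mult norm_power power_le_one diagA_bounds mult_left_le_one_le\<close>)
    finally show ?thesis by simp
  qed
  then have "l2norm (opA x) \<le> 0" by (intro LIMSEQ_le_const[OF lim]) auto
  then have "l2norm (opA x) = 0" using l2norm_nonneg[OF opA_in_l2[OF xl]] by linarith
  then have "opA x = vzero" using xl by (simp add: l2norm_eq_0D)
  then have "pA (opA x) = vzero" "pB (opA x) = vzero" by simp_all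
  then show "x \<in> compC" using xl by (auto simp: compC_def fun_eq_iff)
next
  fix x assume "x \<in> compC"
  then show "x \<in> stable_sub l2 opT"
    using opT_pow_compC_tendsto_0 by (auto simp: stable_sub_def compC_l2)
qed

section \<open>The compressions\<close>

lemma orth_proj_compC:
  assumes x: "x \<in> l2" shows "orth_proj compC x = mk3 vzero vzero (pC x)"
  unfolding orth_proj_def
proof (rule the_equality)
  let ?y = "mk3 vzero vzero (pC x)"
  have y: "?y \<in> compC" using x by (simp add: compC_def)
  have o: "l2inner (vsub x ?y) z = 0" if z: "z \<in> compC" for z
  proof -
    have "vsub (pC x) (pC x) = vzero" by (simp add: fun_eq_iff)
    then show ?thesis
      using l2inner_parts[of "vsub x ?y" z] x z by (simp add: compC_def del: vec_apply)
  qed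
  show "?y \<in> compC \<and> (\<forall>z\<in>compC. l2inner (vsub x ?y) z = 0)" using y o by blast
  fix w assume w: "w \<in> compC \<and> (\<forall>z\<in>compC. l2inner (vsub x w) z = 0)"
  let ?d = "vsub ?y w"
  have d: "?d \<in> compC" using w y lin_subspaceD(5)[OF lin_subspace_compC] by blast
  have "?d = vsub (vsub x w) (vsub x ?y)" by (simp add: fun_eq_iff)
  then have "l2inner ?d ?d = l2inner (vsub x w) ?d - l2inner (vsub x ?y) ?d"
    using x y w d by (metis l2inner_vsub_left l2_vsub compC_l2)
  also have "\<dots> = 0" using w o d by simp
  finally have "?d = vzero" using d compC_l2 l2inner_self_eq_0D by blast
  then show "w = ?y" using vsub_eq_vzeroD by metis
qed

lemma orth_compl_compC: "orth_compl l2 compC = compAB"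
proof (intro equalityI subsetI)
  fix x assume x: "x \<in> orth_compl l2 compC"
  then have xl: "x \<in> l2" by (simp add: orth_compl_def)
  then have m: "mk3 vzero vzero (pC x) \<in> compC" by (simp add: compC_def)
  then have "l2inner x (mk3 vzero vzero (pC x)) = 0" using x by (simp add: orth_compl_def)
  then have "l2inner (pC x) (pC x) = 0"
    using l2inner_parts[OF xl compC_l2[OF m]] by simp
  then show "x \<in> compAB" using l2inner_self_eq_0D[of "pC x"] xl by (simp add: compAB_def)
next
  fix x assume "x \<in> compAB"
  then show "x \<in> orth_compl l2 compC"
    using l2inner_parts[of x] by (auto simp: compAB_def orth_compl_def compC_def simp del: vec_apply)
qed

lemma T00_opT:
  assumes "x \<in> compC" shows "T00 l2 opT x = opT x"
proof -
  have "pA (opT x) = vzero" "pB (opT x) = vzero"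
    using opT_compC[OF assms] unfolding compC_def by blast+
  then have "mk3 vzero vzero (pC (opT x)) = opT x" using mk3_parts[of "opT x"] by simp
  then show ?thesis
    by (simp only: T00_def stable_sub_opT orth_proj_compC[OF opT_in_l2[OF compC_l2[OF assms]]])
qed

lemma T11_opT:
  assumes "x \<in> l2" shows "T11 l2 opT x = mk3 (pA (opT x)) (pB (opT x)) vzero"
  unfolding T11_def stable_sub_opT orth_proj_compC[OF opT_in_l2[OF assms]]
  by (rule vec_eq_partsI) (simp_all add: fun_eq_iff)

lemma pC_opT_compC:
  assumes "x \<in> compC"
  shows "pC (opT x) 0 = 0" "pC (opT x) (Suc j) = of_real (wt j) * pC x j"
  using assms by (simp_all add: compC_def)

lemma compC_eq_vzeroI: "x \<in> compC \<Longrightarrow> (\<And>j. pC x j = 0) \<Longrightarrow> x = vzero"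
  by (rule vec_eq_partsI) (auto simp: compC_def)

text \<open>Members of \<open>N\<close> lie in the range of every power of the shift, and each
  application moves coordinates up by one, leaving a zero. Keeping the preimages inside
  \<open>N\<close> lets the induction on the coordinate proceed.\<close>

lemma opT_divisible_eq_vzero:
  assumes "N \<subseteq> compC" and div: "\<And>x. x \<in> N \<Longrightarrow> \<exists>y\<in>N. x = opT y" and "x \<in> N"
  shows "x = vzero"
proof -
  have "\<forall>x\<in>N. pC x j = 0" for j
  proof (induction j)
    case 0
    show ?case using div pC_opT_compC(1) assms(1) by blast
  next
    case (Suc j)
    show ?case
    proof
      fix x assume "x \<in> N"
      then obtain y where "y \<in> N" "x = opT y" using div by blast
      then show "pC x (Suc j) = 0" using Suc pC_opT_compC(2)[of y j] assms(1) by auto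
    qed
  qed
  then show ?thesis using assms(1,3) by (intro compC_eq_vzeroI) auto
qed

lemma intertw_opT_trivial:
  assumes X: "X \<in> intertw compAB compC (T11 l2 opT) (T00 l2 opT)" and x: "x \<in> compAB"
  shows "X x = vzero"
proof (rule opT_divisible_eq_vzero[of "X ` compAB"])
  show sub: "X ` compAB \<subseteq> compC" using X by (auto simp: intertw_def bounded_op_def)
  fix z assume "z \<in> X ` compAB"
  then obtain y where y: "y \<in> compAB" "z = X y" by blast
  \<comment> \<open>The preimage of \<open>y\<close> under the invertible \<open>T11\<close>: shift
    back, doubling wherever \<open>T11\<close> halves. It makes the image of \<open>X\<close>
    divisible by the shift.\<close>
  define w where "w = mk3 (\<lambda>n. pA y (Suc n)) (case_nat (2 * pA y 0) (smul 2 (pB y))) vzero"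
  have w: "w \<in> compAB" using y by (simp add: w_def compAB_def)
  have "y = T11 l2 opT w"
    by (rule vec_eq_partsI) (use w y in \<open>auto simp: T11_opT compAB_def w_def fun_eq_iff split: nat.split\<close>)
  then have "X y = opT (X w)" using X w sub by (auto simp: intertw_def T00_opT)
  then show "\<exists>y\<in>X ` compAB. z = opT y" using w y by blast
qed (use x in blast)

section \<open>Spectra\<close>

lemma l2norm_finite_support:
  assumes "\<And>k. k \<ge> N \<Longrightarrow> x k = 0"
  shows "(l2norm x)\<^sup>2 = (\<Sum>k<N. (cmod (x k))\<^sup>2)"
proof -
  have "x \<in> l2" by (rule l2_finite_support, rule finite_subset[of _ "{..<N}"]) (use assms in \<open>auto simp: not_le[symmetric]\<close>)
  then show ?thesis
    by (subst l2norm_power2, simp, subst suminf_finite[of "{..<N}"]) (use assms in auto)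
qed

lemma l2_initial_segment [simp]: "(\<lambda>k. if k < N then g k else 0) \<in> l2"
  by (rule l2_finite_support) simp

lemma l2norm_unit_vec [simp]: "l2norm (unit_vec i) = 1"
proof -
  have "complex_of_real ((l2norm (unit_vec i))\<^sup>2) = of_real 1"
    using l2inner_self[OF unit_vec_in_l2, of i] l2inner_unit_vec[of "unit_vec i" i]
    by (simp add: unit_vec_def[of i, THEN fun_cong, of i])
  then have "(l2norm (unit_vec i))\<^sup>2 = 1" using of_real_eq_iff by blast
  then show ?thesis using l2norm_nonneg[OF unit_vec_in_l2, of i] unfolding power2_eq_1_iff by linarith
qed

text \<open>Normalizes the test vectors; the error rate \<open>2 / sqrt (n + 1)\<close> is the one
  that both applications below achieve.\<close>

lemma approx_point_specI:
  assumes H: "lin_subspace H" and TH: "\<And>x. x \<in> H \<Longrightarrow> T x \<in> H"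
    and hom: "\<And>c x. x \<in> H \<Longrightarrow> T (smul c x) = smul c (T x)"
    and v: "\<And>n. v n \<in> H" "\<And>n. v n \<noteq> vzero"
    and le: "\<And>n. l2norm (vsub (T (v n)) (smul l (v n))) * sqrt (real (n + 1)) \<le> 2 * l2norm (v n)"
  shows "l \<in> approx_point_spec H T"
proof -
  define c where "c n = complex_of_real (inverse (l2norm (v n)))" for n
  define s where "s n = smul (c n) (v n)" for n
  have vl: "v n \<in> l2" "T (v n) \<in> l2" for n using H v TH lin_subspaceD(1) by blast+
  have pos: "0 < l2norm (v n)" for n
    using l2norm_nonneg[OF vl(1)[of n]] l2norm_eq_0D[OF vl(1)[of n]] v(2)[of n] by linarith
  have s: "s n \<in> H" "l2norm (s n) = 1" for n
    using lin_subspaceD(4)[OF H] v(1) vl pos[of n] by (auto simp: s_def c_def l2norm_smul norm_inverse)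
  have up: "l2norm (vsub (T (s n)) (smul l (s n))) \<le> 2 / sqrt (real (n + 1))" for n
  proof -
    have "vsub (T (s n)) (smul l (s n)) = smul (c n) (vsub (T (v n)) (smul l (v n)))"
      unfolding s_def hom[OF v(1)] by (simp add: fun_eq_iff algebra_simps)
    then have eq: "l2norm (vsub (T (s n)) (smul l (s n)))
        = l2norm (vsub (T (v n)) (smul l (v n))) / l2norm (v n)"
      using vl pos[of n] by (simp add: l2norm_smul c_def norm_inverse divide_inverse)
    show ?thesis unfolding eq using le[of n] pos[of n] by (simp add: divide_simps mult.commute)
  qed
  have lim: "(\<lambda>n. 2 / sqrt (real (n + 1))) \<longlonglongrightarrow> 0"
  proof -
    have "(\<lambda>n. sqrt (4 / real (n + 1))) \<longlonglongrightarrow> sqrt 0"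
      by (intro tendsto_real_sqrt LIMSEQ_ignore_initial_segment[OF lim_const_over_n, of _ 1])
    then show ?thesis by (simp add: real_sqrt_divide)
  qed
  have nn: "0 \<le> l2norm (vsub (T (s n)) (smul l (s n)))" for n
    using lin_subspaceD(1)[OF H] s(1)[of n] TH[OF s(1)[of n]] by simp
  have "(\<lambda>n. l2norm (vsub (T (s n)) (smul l (s n)))) \<longlonglongrightarrow> 0"
    by (rule tendsto_sandwich[OF _ _ tendsto_const lim]) (intro always_eventually allI nn up)+
  then show ?thesis using s by (auto simp: approx_point_spec_def)
qed

lemma contraction_T00: "contraction compC (T00 l2 opT)"
  using contraction_opT lin_subspaceD(3,4)[OF lin_subspace_compC]
  by (auto simp: contraction_def bounded_op_def T00_opT opT_compC compC_l2 intro!: exI[of _ 1])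

text \<open>The backward weighted shift on the \<open>f_j\<close>, which is the adjoint of
  \<open>T00\<close> taken inside \<open>compC\<close>.\<close>

definition opSs :: op where
  "opSs y = mk3 vzero vzero (\<lambda>j. of_real (wt j) * pC y (Suc j))"

lemma opSs_compC: "y \<in> l2 \<Longrightarrow> opSs y \<in> compC"
  using l2_wt[OF l2_tail[of "pC y"]] by (simp add: opSs_def compC_def)

lemma l2inner_opSs:
  assumes x: "x \<in> compC" and y: "y \<in> compC"
  shows "l2inner (opT x) y = l2inner x (opSs y)"
  using x y l2inner_opT[OF compC_l2 compC_l2, OF x y]
    l2inner_parts[OF compC_l2[OF x] opTs_in_l2[OF compC_l2[OF y]]]
    l2inner_parts[OF compC_l2[OF x] compC_l2[OF opSs_compC[OF compC_l2[OF y]]]]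
  by (simp add: compC_def opSs_def del: vec_apply)

lemma opSs_linear: "opSs (vadd x y) = vadd (opSs x) (opSs y)" "opSs (smul c x) = smul c (opSs x)"
  by (rule vec_eq_partsI; auto simp: opSs_def fun_eq_iff algebra_simps)+

lemma adj_T00:
  assumes y: "y \<in> compC" shows "adj compC compC (T00 l2 opT) y = opSs y"
proof (rule adj_eqI[OF lin_subspace_compC _ y])
  have inner: "l2inner (T00 l2 opT x) y = l2inner x (opSs y)" if "x \<in> compC" "y \<in> compC" for x y
    using that by (simp add: T00_opT l2inner_opSs)
  have "l2norm (opSs y) \<le> l2norm y" if "y \<in> compC" for y
    using adjoint_contraction[OF lin_subspace_compC contraction_T00 _ inner that] opSs_compC compC_l2
    by blast
  then show "is_adjoint compC compC (T00 l2 opT) opSs"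
    using inner by (auto simp: is_adjoint_def bounded_op_def opSs_linear opSs_compC compC_l2 intro!: exI[of _ 1])
qed

lemma one_in_approx_point_spec_adj_T00: "1 \<in> approx_point_spec compC (adj compC compC (T00 l2 opT))"
proof (rule approx_point_specI)
  \<comment> \<open>The formal solution of \<open>opSs v = v\<close> has coordinates
    \<open>1 / wtprod k\<close>; \<open>g n\<close> truncates it. Only coordinate \<open>n\<close>
    violates the equation, by \<open>sqrt (n + 1)\<close>, whereas the norm of \<open>v n\<close>
    grows like \<open>n\<close>.\<close>
  define g where "g n = (\<lambda>k. if k < Suc n then complex_of_real (sqrt (real (k + 1))) else 0)" for n
  define v where "v n = mk3 vzero vzero (g n)" for n
  have g: "g n \<in> l2" for n unfolding g_def by (rule l2_initial_segment)
  show v: "v n \<in> compC" for n using g by (simp add: v_def compC_def)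
  show "v n \<noteq> vzero" for n
  proof
    assume "v n = vzero"
    then have "pC (v n) 0 = 0" by simp
    then show False by (simp add: v_def g_def)
  qed
  have norm: "(l2norm (v n))\<^sup>2 = real (Suc n) * real (n + 2) / 2" for n
  proof -
    have "(l2norm (v n))\<^sup>2 = (l2norm (g n))\<^sup>2" using l2norm_compC[OF v] by (simp add: v_def)
    also have "\<dots> = (\<Sum>k<Suc n. (cmod (g n k))\<^sup>2)" by (rule l2norm_finite_support) (simp add: g_def)
    also have "\<dots> = (\<Sum>k<Suc n. real (k + 1))" by (rule sum.cong) (simp_all add: g_def)
    also have "\<dots> = real (Suc n) * real (n + 2) / 2"
      by (induction n) (simp_all add: field_simps)
    finally show ?thesis .
  qed
  show "l2norm (vsub (adj compC compC (T00 l2 opT) (v n)) (smul 1 (v n))) * sqrt (real (n + 1))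
      \<le> 2 * l2norm (v n)" for n
  proof -
    let ?d = "vsub (opSs (v n)) (smul 1 (v n))"
    have d: "?d \<in> compC"
      using v opSs_compC compC_l2 lin_subspaceD(4,5)[OF lin_subspace_compC] by blast
    have "wt j * sqrt (real (Suc j + 1)) = sqrt (real (j + 1))" for j
      by (simp add: wt_def real_sqrt_divide add.commute)
    then have "complex_of_real (wt j) * of_real (sqrt (real (Suc j + 1))) = of_real (sqrt (real (j + 1)))" for j
      by (metis of_real_mult)
    then have "pC ?d = smul (- of_real (sqrt (real (n + 1)))) (unit_vec n)"
      by (auto simp: opSs_def v_def g_def unit_vec_def fun_eq_iff)
    then have "l2norm ?d = sqrt (real (n + 1))"
      using l2norm_compC[OF d] by (simp add: l2norm_smul)
    moreover have "real (n + 1) \<le> 2 * l2norm (v n)"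
    proof (rule power2_le_imp_le)
      show "(real (n + 1))\<^sup>2 \<le> (2 * l2norm (v n))\<^sup>2"
        unfolding power_mult_distrib norm by (simp add: power2_eq_square algebra_simps)
    qed (use compC_l2[OF v] in simp)
    ultimately show ?thesis by (simp add: adj_T00[OF v])
  qed
qed (auto simp: adj_T00 opSs_compC compC_l2 opSs_linear lin_subspace_compC lin_subspaceD(4)[OF lin_subspace_compC])

lemma lin_subspace_compAB: "lin_subspace compAB"
  by (auto simp: lin_subspace_def compAB_def fun_eq_iff)

lemma T11_smul: "x \<in> l2 \<Longrightarrow> T11 l2 opT (smul c x) = smul c (T11 l2 opT x)"
  by (rule vec_eq_partsI) (auto simp: T11_opT fun_eq_iff split: nat.split)

lemma one_in_approx_point_spec_T11: "1 \<in> approx_point_spec compAB (T11 l2 opT)"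
proof (rule approx_point_specI)
  \<comment> \<open>\<open>v n\<close> is \<open>e_0 + ... + e_n\<close>. The shift changes only the
    two ends, so the error has norm at most 2 against a norm of \<open>sqrt (n + 1)\<close>.\<close>
  define g :: "nat \<Rightarrow> vec" where "g n = (\<lambda>k. if k < Suc n then 1 else 0)" for n
  define v where "v n = mk3 (g n) vzero vzero" for n
  have g: "g n \<in> l2" for n unfolding g_def by (rule l2_initial_segment)
  then have vl: "v n \<in> l2" for n by (simp add: v_def)
  show "v n \<in> compAB" for n using g by (simp add: v_def compAB_def)
  show "v n \<noteq> vzero" for n
  proof
    assume "v n = vzero"
    then have "pA (v n) 0 = 0" by simp
    then show False by (simp add: v_def g_def)
  qed
  have norm: "l2norm (v n) = sqrt (real (n + 1))" for n
  proof -
    have "(l2norm (v n))\<^sup>2 = (l2norm (g n))\<^sup>2" using l2norm_parts[OF vl[of n]] by (simp add: v_def)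
    also have "\<dots> = (\<Sum>k<Suc n. (cmod (g n k))\<^sup>2)" by (rule l2norm_finite_support) (simp add: g_def)
    also have "\<dots> = (\<Sum>k<Suc n. 1)" by (rule sum.cong) (simp_all add: g_def)
    finally show ?thesis using vl[of n] by (intro real_sqrt_unique[symmetric]) (simp_all add: add.commute)
  qed
  show "l2norm (vsub (T11 l2 opT (v n)) (smul 1 (v n))) * sqrt (real (n + 1)) \<le> 2 * l2norm (v n)" for n
  proof -
    have "vsub (T11 l2 opT (v n)) (smul 1 (v n))
        = mk3 (vsub (unit_vec (Suc n)) (unit_vec 0)) vzero vzero"
      by (rule vec_eq_partsI)
        (auto simp: T11_opT vl v_def g_def unit_vec_def fun_eq_iff split: nat.split)
    moreover have "l2norm (mk3 u vzero vzero) = l2norm u" if "u \<in> l2" for u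
      using l2norm_parts[of "mk3 u vzero vzero"] that by simp
    ultimately have "l2norm (vsub (T11 l2 opT (v n)) (smul 1 (v n))) \<le> 2"
      using l2norm_vsub_le[of "unit_vec (Suc n)" "unit_vec 0"] by simp
    then show ?thesis unfolding norm by (rule mult_right_mono) simp
  qed
qed (auto simp: lin_subspace_compAB T11_smul compAB_l2, simp add: T11_opT compAB_def)

text \<open>Along \<open>e_0, e_1, ...\<close> the moduli of the coefficients cannot decrease, so
  square summability forces them to vanish. The equation at \<open>e_0\<close> then kills the first
  negative coefficient, the recursion kills the others, and what remains is an eigenvector equation
  for the injective shift.\<close>

lemma opT_no_eigenvalue:
  assumes x: "x \<in> l2" and eig: "opT x = smul l x" and l: "cmod l < 1"
  shows "x = vzero"
proof -
  have "pA (opT x) = smul l (pA x)" "pB (opT x) = smul l (pB x)" "pC (opT x) = smul l (pC x)"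
    using eig by simp_all
  then have A: "case_nat (pB x 0 / 2) (pA x) k = l * pA x k" and B: "pB x (Suc k) / 2 = l * pB x k"
    and C: "case_nat (l2inner (pB x) geo) (\<lambda>j. of_real (wt j) * pC x j) k = l * pC x k" for k
    unfolding parts_opT by (metis vec_apply(3))+
  have inc: "cmod (pA x k) \<le> cmod (pA x (Suc k))" for k
    using A[of "Suc k"] l by (simp add: norm_mult mult_left_le_one_le)
  have a: "pA x k = 0" for k
  proof -
    have "summable (\<lambda>n. (cmod (pA x n))\<^sup>2)" using l2_parts(1)[OF x] by (simp only: l2_iff)
    then have lim: "(\<lambda>n. (cmod (pA x n))\<^sup>2) \<longlonglongrightarrow> 0" by (rule summable_LIMSEQ_zero)
    have "(cmod (pA x k))\<^sup>2 \<le> (cmod (pA x n))\<^sup>2" if "n \<ge> k" for n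
      by (intro power_mono lift_Suc_mono_le[of "\<lambda>n. cmod (pA x n)", OF inc that]) simp
    then have "(cmod (pA x k))\<^sup>2 \<le> 0" by (intro LIMSEQ_le_const[OF lim]) blast
    then show ?thesis by simp
  qed
  have b: "pB x k = 0" for k
  proof (induction k)
    case 0 show ?case using A[of 0] a by simp
  next
    case (Suc k) then show ?case using B[of k] by simp
  qed
  have "pB x = vzero" using b by (simp add: fun_eq_iff)
  then have c0: "l * pC x 0 = 0" using C[of 0] by simp
  have cS: "of_real (wt j) * pC x j = l * pC x (Suc j)" for j using C[of "Suc j"] by simp
  have c: "pC x k = 0" for k
  proof (cases "l = 0")
    \<comment> \<open>Here \<open>c0\<close> carries no information; positivity of the weights
      decides instead.\<close>
    case True
    then show ?thesis using cS[of k] wt_bounds(1)[of k] by simp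
  next
    case False
    show ?thesis
    proof (induction k)
      case 0 show ?case using c0 False by simp
    next
      case (Suc k) then show ?case using cS[of k] False by simp
    qed
  qed
  show ?thesis by (rule vec_eq_partsI) (use a b c in \<open>simp_all add: fun_eq_iff\<close>)
qed

section \<open>Invariant complements\<close>

lemma half_le_wt: "1 / 2 \<le> wt j"
  unfolding wt_def by (rule real_le_rsqrt) (simp add: power2_eq_square field_simps)

text \<open>The weights are at least \<open>1/2\<close>, so dividing by them preserves square
  summability: the range of the shift is the whole hyperplane where coordinate 0 vanishes.\<close>

lemma compC_opT_preimage:
  assumes x: "x \<in> compC" and x0: "pC x 0 = 0" shows "\<exists>y\<in>compC. x = opT y"
proof
  define c where "c = (\<lambda>j. pC x (Suc j) / of_real (wt j))"
  have "c \<in> l2"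
  proof (rule l2_dominated(1)[where B = 2])
    show "(\<lambda>j. pC x (Suc j)) \<in> l2" using compC_l2[OF x] by simp
    fix j
    have "cmod (pC x (Suc j)) * 1 \<le> cmod (pC x (Suc j)) * (2 * wt j)"
      using half_le_wt[of j] by (intro mult_left_mono) auto
    then show "cmod (c j) \<le> 2 * cmod (pC x (Suc j))"
      using wt_bounds(1)[of j] by (simp add: c_def norm_divide divide_le_eq mult_ac)
  qed simp
  then show "mk3 vzero vzero c \<in> compC" by (simp add: compC_def)
  have "wt j \<noteq> 0" for j using wt_bounds(1)[of j] by simp
  then show "x = opT (mk3 vzero vzero c)"
    by (intro vec_eq_partsI[of x "opT (mk3 vzero vzero c)"])
      (use x x0 in \<open>auto simp: compC_def c_def fun_eq_iff split: nat.split\<close>)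
qed

text \<open>The quotient of \<open>compC\<close> by its image under \<open>opT\<close> is one-dimensional, and it is the direct sum of
  the quotients of \<open>P\<close> and \<open>Q\<close>; once \<open>P\<close> accounts for it, \<open>Q\<close> consists of infinitely
  \<open>opT\<close>-divisible vectors.\<close>

lemma invariant_complement_trivial:
  assumes P: "lin_subspace P" "P \<subseteq> compC" "\<And>x. x \<in> P \<Longrightarrow> opT x \<in> P"
    and Q: "lin_subspace Q" "Q \<subseteq> compC" "\<And>x. x \<in> Q \<Longrightarrow> opT x \<in> Q"
    and PQ: "P \<inter> Q \<subseteq> {vzero}" "\<And>x. x \<in> compC \<Longrightarrow> \<exists>p\<in>P. \<exists>q\<in>Q. x = vadd p q"
    and u: "u \<in> P" "pC u 0 \<noteq> 0"
    and x: "x \<in> Q"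
  shows "x = vzero"
proof (rule opT_divisible_eq_vzero[OF Q(2) _ x])
  fix n assume n: "n \<in> Q"
  \<comment> \<open>Chosen to cancel coordinate 0, which puts \<open>n - k u\<close> into the range
    of the shift.\<close>
  define k where "k = pC n 0 / pC u 0"
  have "vsub n (smul k u) \<in> compC"
    using n u P(2) Q(2) lin_subspaceD(4,5)[OF lin_subspace_compC] by blast
  moreover have "pC (vsub n (smul k u)) 0 = 0" using u(2) by (simp add: k_def)
  ultimately obtain y where y: "y \<in> compC" "vsub n (smul k u) = opT y"
    using compC_opT_preimage by blast
  obtain p q where pq: "p \<in> P" "q \<in> Q" "y = vadd p q" using PQ(2)[OF y(1)] by blast
  have "opT y = vadd (opT p) (opT q)"
    unfolding pq(3) using pq P(2) Q(2) compC_l2 by (intro bounded_opD(2)[OF bounded_op_opT]) auto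
  then have "vsub n (smul k u) = vadd (opT p) (opT q)" using y(2) by simp
  then have "n i - k * u i = opT p i + opT q i" for i by (metis vec_apply(1,2,3))
  \<comment> \<open>The left side is in \<open>Q\<close> and the right side in \<open>P\<close>, so
    both vanish and \<open>n = opT q\<close>.\<close>
  then have "vsub n (opT q) = vadd (smul k u) (opT p)" by (simp add: fun_eq_iff algebra_simps)
  moreover have "vadd (smul k u) (opT p) \<in> P"
    using pq u lin_subspaceD(3,4)[OF P(1)] P(3) by blast
  moreover have "vsub n (opT q) \<in> Q" using n pq lin_subspaceD(5)[OF Q(1)] Q(3) by blast
  ultimately have "vsub n (opT q) = vzero" using PQ(1) by auto
  then show "\<exists>y\<in>Q. n = opT y" using vsub_eq_vzeroD pq(2) by blast
qed

text \<open>\<open>M\<close> is the graph of \<open>Z\<close>, and \<open>h m\<close> is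
  \<open>Z\<close> at the \<open>m\<close>-th vector of a rescaled backward orbit of
  \<open>e_0\<close>. Invariance of \<open>M\<close> fixes all coordinates of every
  \<open>h m\<close> as the \<open>wtprod j\<close>, which are not square summable.\<close>

lemma opT_no_complement_compC:
  assumes M: "lin_subspace M" "\<And>x. x \<in> M \<Longrightarrow> opT x \<in> M" "M \<inter> compC \<subseteq> {vzero}"
    and sum: "\<And>x. x \<in> l2 \<Longrightarrow> \<exists>y\<in>compC. vadd x y \<in> M"
  shows False
proof -
  define f where "f = mk3 vzero vzero (unit_vec 0)"
  \<comment> \<open>\<open>E (Suc k)\<close> is \<open>2^(k+1) e_(-k-1)\<close>; the factor undoes
    the halvings and the decay of \<open>geo\<close>, so that each step adds exactly
    \<open>f\<close>.\<close>
  define E where "E m = (case m of 0 \<Rightarrow> mk3 (unit_vec 0) vzero vzero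
      | Suc k \<Rightarrow> mk3 vzero (smul (2 ^ Suc k) (unit_vec k)) vzero)" for m
  have E: "E m \<in> l2" for m by (simp add: E_def split: nat.split)
  have f: "f \<in> l2" "f \<in> compC" by (simp_all add: f_def compC_def)
  have "l2inner (unit_vec k) geo = geo k" for k
    using l2inner_commute[of geo "unit_vec k"] by simp
  then have "2 ^ Suc k * l2inner (unit_vec k) geo = 1" for k
    by (simp add: geo_def power_one_over)
  then have TE: "opT (E (Suc m)) = vadd (E m) f" for m
    by (intro vec_eq_partsI[of "opT (E (Suc m))" "vadd (E m) f"])
      (auto simp: E_def f_def fun_eq_iff unit_vec_def[THEN fun_cong] l2inner_linear split: nat.split)
  obtain h where h: "\<And>m. h m \<in> compC" "\<And>m. vadd (E m) (h m) \<in> M"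
    using sum[OF E] by metis
  have hl: "h m \<in> l2" for m using h compC_l2 by blast
  have rec: "h m = vadd f (opT (h (Suc m)))" for m
  proof -
    let ?z = "vsub (vadd f (opT (h (Suc m)))) (h m)"
    have "opT (vadd (E (Suc m)) (h (Suc m))) = vadd (vadd (E m) f) (opT (h (Suc m)))"
      using E hl by (simp add: bounded_opD(2)[OF bounded_op_opT] TE)
    then have "?z = vsub (opT (vadd (E (Suc m)) (h (Suc m)))) (vadd (E m) (h m))"
      by (simp add: fun_eq_iff)
    moreover have "vsub (opT (vadd (E (Suc m)) (h (Suc m)))) (vadd (E m) (h m)) \<in> M"
      using h(2) M(2) lin_subspaceD(5)[OF M(1)] by blast
    ultimately have "?z \<in> M" by simp
    moreover have "?z \<in> compC"
      using h(1) f opT_compC lin_subspaceD(3,5)[OF lin_subspace_compC] by blast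
    ultimately have "?z = vzero" using M(3) by blast
    then show ?thesis using vsub_eq_vzeroD by metis
  qed
  have "pC (h m) j = of_real (wtprod j)" for m j
  proof (induction j arbitrary: m)
    case 0
    have "pC (h m) 0 = pC (vadd f (opT (h (Suc m)))) 0" using rec by metis
    then show ?case using pC_opT_compC(1)[OF h(1)[of "Suc m"]] by (simp add: f_def unit_vec_def)
  next
    case (Suc j)
    have "pC (h m) (Suc j) = pC (vadd f (opT (h (Suc m)))) (Suc j)" using rec by metis
    then show ?case using pC_opT_compC(2)[OF h(1)[of "Suc m"]] Suc
      by (simp add: f_def unit_vec_def wtprod_Suc)
  qed
  then have "pC (h 0) = (\<lambda>j. of_real (wtprod j))" by (simp add: fun_eq_iff)
  then show False using l2_parts(3)[OF hl[of 0]] wtprod_not_l2 by simp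
qed

text \<open>As \<open>M0\<close> lies in \<open>compC\<close>, the trace
  \<open>M1 \<inter> compC\<close> complements it there. Splitting \<open>f_0\<close> shows that one
  of the two has a vector with nonzero coordinate 0, and then the other is trivial.
  \<open>M0\<close> is not, so the trace is, and \<open>M1\<close> complements
  \<open>compC\<close>.\<close>

lemma opT_no_decomposition:
  assumes M0: "lin_subspace M0" "M0 \<subseteq> compC" "\<And>x. x \<in> M0 \<Longrightarrow> opT x \<in> M0" "M0 \<noteq> {vzero}"
    and M1: "lin_subspace M1" "\<And>x. x \<in> M1 \<Longrightarrow> opT x \<in> M1"
    and int: "M0 \<inter> M1 = {vzero}" and sum: "{vadd x y | x y. x \<in> M0 \<and> y \<in> M1} = l2"
  shows False
proof -
  let ?N = "M1 \<inter> compC"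
  have N: "lin_subspace ?N"
    using M1(1) lin_subspace_compC by (auto simp: lin_subspace_def)
  have NT: "opT x \<in> ?N" if "x \<in> ?N" for x using that M1(2) opT_compC by blast
  have dec: "\<exists>p\<in>M0. \<exists>q\<in>M1. x = vadd p q" if "x \<in> l2" for x using that sum by blast
  have decC: "\<exists>p\<in>M0. \<exists>q\<in>?N. x = vadd p q" if x: "x \<in> compC" for x
  proof -
    obtain p q where pq: "p \<in> M0" "q \<in> M1" "x = vadd p q" using dec compC_l2[OF x] by blast
    have "q = vsub x p" by (simp add: pq(3) fun_eq_iff)
    then have "q \<in> compC" using x pq(1) M0(2) lin_subspaceD(5)[OF lin_subspace_compC] by blast
    then show ?thesis using pq by blast
  qed
  define f where "f = mk3 vzero vzero (unit_vec 0)"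
  have "f \<in> compC" by (simp add: f_def compC_def)
  then obtain u v where uv: "u \<in> M0" "v \<in> ?N" "f = vadd u v" using decC by blast
  have "pC f 0 = 1" by (simp add: f_def unit_vec_def)
  then have uv0: "pC u 0 + pC v 0 = 1" unfolding uv(3) by simp
  have "pC v 0 = 0"
  proof (rule ccontr)
    assume v0: "pC v 0 \<noteq> 0"
    have "x = vzero" if "x \<in> M0" for x
    proof (rule invariant_complement_trivial[OF N _ NT M0(1,2,3) _ _ uv(2) v0 that])
      show "\<exists>p\<in>?N. \<exists>q\<in>M0. y = vadd p q" if y: "y \<in> compC" for y
      proof -
        obtain p q where "p \<in> M0" "q \<in> ?N" "y = vadd p q" using decC[OF y] by blast
        moreover have "vadd p q = vadd q p" by (simp add: fun_eq_iff add.commute)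
        ultimately show ?thesis by metis
      qed
    qed (use int in auto)
    then show False using M0(4) lin_subspaceD(2)[OF M0(1)] by blast
  qed
  then have u0: "pC u 0 \<noteq> 0" using uv0 by auto
  have Nz: "?N \<subseteq> {vzero}"
    using invariant_complement_trivial[OF M0(1,2,3) N _ NT _ decC uv(1) u0] int by blast
  show False
  proof (rule opT_no_complement_compC[OF M1 Nz])
    fix x assume "x \<in> l2"
    then obtain p q where pq: "p \<in> M0" "q \<in> M1" "x = vadd p q" using dec by blast
    have "smul (-1) p \<in> compC" using pq M0(2) lin_subspaceD(4)[OF lin_subspace_compC] by blast
    moreover have "vadd x (smul (-1) p) = q" by (simp add: pq(3) fun_eq_iff)
    ultimately show "\<exists>y\<in>compC. vadd x y \<in> M1" using pq(2) by metis
  qed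
qed

section \<open>A nonzero commuting operator with stable range\<close>

text \<open>The block \<open>pC \<rightarrow> pC\<close> is \<open>I - S\<close>, the others are \<open>-(I - S) Z\<close>, where \<open>Z e\<^sub>k\<close> is the sum of
  \<open>wtprod j \<cdot> f\<^sub>j\<close> over \<open>j \<ge> k\<close>, multiplied by \<open>2\<^bsup>k\<^esup>\<close> if \<open>k < 0\<close>; multiplication by \<open>I - S\<close> makes the
  sum telescope.\<close>

definition opC :: op where
  "opC x = mk3 vzero vzero
     (vsub (vsub (vsub (pC x) (case_nat 0 (\<lambda>j. of_real (wt j) * pC x j))) (\<lambda>j. of_real (wtprod j) * pA x j))
       (smul (l2inner (pB x) geo) (unit_vec 0)))"

lemma parts_opC [simp]:
  "pA (opC x) = vzero" "pB (opC x) = vzero"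
  "pC (opC x) = vsub (vsub (vsub (pC x) (case_nat 0 (\<lambda>j. of_real (wt j) * pC x j))) (\<lambda>j. of_real (wtprod j) * pA x j))
       (smul (l2inner (pB x) geo) (unit_vec 0))"
  by (simp_all add: opC_def)

lemma l2_wtprod [simp]: "a \<in> l2 \<Longrightarrow> (\<lambda>j. of_real (wtprod j) * a j) \<in> l2"
  and l2norm_wtprod_le: "a \<in> l2 \<Longrightarrow> l2norm (\<lambda>j. of_real (wtprod j) * a j) \<le> l2norm a"
  using l2_dominated[of a "\<lambda>j. of_real (wtprod j) * a j" 1] wtprod_bounds
  by (auto simp: norm_mult mult_left_le_one_le less_imp_le)

lemma opC_compC: "x \<in> l2 \<Longrightarrow> opC x \<in> compC"
  by (simp add: opC_def compC_def)

lemma l2norm_parts_le: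
  assumes x: "x \<in> l2"
  shows "l2norm (pA x) \<le> l2norm x" "l2norm (pB x) \<le> l2norm x" "l2norm (pC x) \<le> l2norm x"
  by (rule power2_le_imp_le; simp add: l2norm_parts[OF x] x)+

lemma l2norm_opC_le:
  assumes x: "x \<in> l2" shows "l2norm (opC x) \<le> 4 * l2norm x"
proof -
  let ?s = "case_nat 0 (\<lambda>j. of_real (wt j) * pC x j)" and ?a = "\<lambda>j. of_real (wtprod j) * pA x j"
    and ?g = "smul (l2inner (pB x) geo) (unit_vec 0)"
  have l: "pC x \<in> l2" "?s \<in> l2" "?a \<in> l2" "?g \<in> l2" using x by simp_all
  have "l2norm (opC x) = l2norm (pC (opC x))" by (rule l2norm_compC[OF opC_compC[OF x]])
  also have "\<dots> \<le> l2norm (pC x) + l2norm ?s + l2norm ?a + l2norm ?g"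
    using l2norm_vsub_le[of "vsub (vsub (pC x) ?s) ?a" ?g] l2norm_vsub_le[of "vsub (pC x) ?s" ?a]
      l2norm_vsub_le[of "pC x" ?s] l by simp
  also have "l2norm ?s \<le> l2norm (pC x)"
    by (rule power2_le_imp_le) (use x in \<open>simp_all add: l2norm_case_nat l2norm_wt_le power_mono\<close>)
  also have "l2norm ?a \<le> l2norm (pA x)" using x by (simp add: l2norm_wtprod_le)
  also have "l2norm ?g \<le> l2norm (pB x)"
  proof -
    have "(cmod (l2inner (pB x) geo))\<^sup>2 \<le> (l2norm (pB x))\<^sup>2"
      using l2inner_geo_le[OF l2_parts(2)[OF x]] zero_le_power2[of "l2norm (pB x)"] by linarith
    then have "cmod (l2inner (pB x) geo) \<le> l2norm (pB x)" by (rule power2_le_imp_le) (use x in simp)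
    then show ?thesis by (simp add: l2norm_smul)
  qed
  finally show ?thesis using l2norm_parts_le[OF x] by simp
qed

lemma bounded_op_opC: "bounded_op l2 l2 opC"
proof -
  have "opC (vadd x y) = vadd (opC x) (opC y)" if "x \<in> l2" "y \<in> l2" for x y
    by (rule vec_eq_partsI) (use that in \<open>auto simp: fun_eq_iff l2inner_linear algebra_simps split: nat.split\<close>)
  moreover have "opC (smul c x) = smul c (opC x)" if "x \<in> l2" for c x
    by (rule vec_eq_partsI) (use that in \<open>auto simp: fun_eq_iff l2inner_linear algebra_simps split: nat.split\<close>)
  ultimately show ?thesis
    unfolding bounded_op_def using l2norm_opC_le opC_compC compC_l2 by blast
qed

text \<open>By \<open>geo (Suc n) = geo n / 2\<close>, the halved backward shift of \<open>b\<close>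
  pairs with \<open>geo\<close> like \<open>b\<close> without its first term. In
  \<open>opC_opT\<close> the lost \<open>b 0 / 2\<close> is cancelled by the new coefficient at
  \<open>e_0\<close>.\<close>

lemma l2inner_geo_tail:
  assumes "b \<in> l2" shows "l2inner (\<lambda>n. b (Suc n) / 2) geo = l2inner b geo - b 0 / 2"
proof -
  have b: "b = case_nat (b 0) (\<lambda>n. b (Suc n))" by (simp add: fun_eq_iff split: nat.split)
  have "l2inner b geo = b 0 * cnj (geo 0) + l2inner (\<lambda>n. b (Suc n)) (\<lambda>n. geo (Suc n))"
    using assms by (subst b, subst l2inner_case_nat) auto
  also have "l2inner (\<lambda>n. b (Suc n)) (\<lambda>n. geo (Suc n)) = l2inner (\<lambda>n. b (Suc n) / 2) geo"
    by (simp add: l2inner_def geo_def)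
  finally show ?thesis by (simp add: geo_def[of 0])
qed

lemma opC_opT:
  assumes x: "x \<in> l2" shows "opC (opT x) = opT (opC x)"
proof (rule vec_eq_partsI)
  show "pC (opC (opT x)) = pC (opT (opC x))"
  proof
    fix j
    show "pC (opC (opT x)) j = pC (opT (opC x)) j"
    proof (cases j)
      case 0
      then show ?thesis using l2inner_geo_tail[OF l2_parts(2)[OF x]] by (simp add: unit_vec_def)
    next
      \<comment> \<open>Coordinate 1 is separate because the \<open>f_0\<close> terms reach it
        through the shift; beyond it only \<open>wtprod_Suc\<close> matters.\<close>
      case (Suc i)
      then show ?thesis
        by (cases i) (auto simp: unit_vec_def wtprod_Suc algebra_simps)
    qed
  qed
qed (simp_all add: fun_eq_iff split: nat.split)

lemma opC_in_commutant: "opC \<in> commutant l2 opT"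
  by (simp add: commutant_def intertw_def bounded_op_opC opC_opT)

section \<open>Failure of injectivity of the commutant mapping\<close>

lemma vzero_in_Hplus: "vzero \<in> Hplus l2 opT"
proof -
  have "A_T l2 opT vzero = vzero" by (simp add: A_T_opT opA_def fun_eq_iff)
  moreover have "vsub vzero vzero = vzero" by (simp add: fun_eq_iff)
  ultimately show ?thesis unfolding Hplus_def l2closure_def
    by (auto simp: l2conv_def image_iff intro!: exI[of _ "\<lambda>n. vzero"] bexI[of _ vzero])
qed

text \<open>\<open>X_T\<close> annihilates the range of \<open>C\<close>, so both sides of the
  intertwining relation are zero, whichever dilation is used.\<close>

lemma gamma_rel_zero:
  assumes dil: "min_unitary_dilation (Hplus l2 opT) V K J W"
    and C: "C \<in> commutant l2 opT" "\<And>x. x \<in> l2 \<Longrightarrow> C x \<in> compC"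
  shows "gamma_rel l2 opT K J W C (\<lambda>x. vzero)"
proof -
  have "vzero \<in> K" "bounded_op K K W" "bounded_op (Hplus l2 opT) K J"
    using dil by (auto simp: min_unitary_dilation_def closed_subspace_def lin_subspace_def unitary_op_def)
  then show ?thesis
    using C bounded_op_vzero[OF _ vzero_in_Hplus] zero_in_commutant
    by (auto simp: gamma_rel_def X_T_compC)
qed

theorem mainTheorem15:
  shows "\<exists>H T. closed_subspace H \<and> contraction H T
    \<and> (\<forall>X\<in>intertw (orth_compl H (stable_sub H T)) (stable_sub H T) (T11 H T) (T00 H T).
          \<forall>x\<in>orth_compl H (stable_sub H T). X x = vzero)
    \<and> cnj ` approx_point_spec (stable_sub H T)
              (adj (stable_sub H T) (stable_sub H T) (T00 H T))
        \<inter> approx_point_spec (orth_compl H (stable_sub H T)) (T11 H T) \<noteq> {}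
    \<and> point_spec H T \<inter> cnj ` point_spec H (adj H H T) \<inter> {z. cmod z < 1} = {}
    \<and> \<not> (\<exists>M0 M1. closed_subspace M0 \<and> closed_subspace M1 \<and> M0 \<subseteq> H \<and> M1 \<subseteq> H
          \<and> (\<forall>x\<in>M0. T x \<in> M0) \<and> (\<forall>x\<in>M1. T x \<in> M1)
          \<and> M0 \<inter> M1 = {vzero} \<and> {vadd x y | x y. x \<in> M0 \<and> y \<in> M1} = H
          \<and> M0 \<noteq> {vzero} \<and> M0 \<subseteq> stable_sub H T)
    \<and> (\<forall>K J W. min_unitary_dilation (Hplus H T) (V_T H T) K J W \<longrightarrow>
          (\<exists>C1 C2 D. gamma_rel H T K J W C1 D \<and> gamma_rel H T K J W C2 D
              \<and> (\<exists>x\<in>H. C1 x \<noteq> C2 x)))"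
proof (intro exI[of _ l2] exI[of _ opT] conjI, unfold stable_sub_opT orth_compl_compC)
  show "\<forall>X\<in>intertw compAB compC (T11 l2 opT) (T00 l2 opT). \<forall>x\<in>compAB. X x = vzero"
    using intertw_opT_trivial by blast
  have "1 \<in> cnj ` approx_point_spec compC (adj compC compC (T00 l2 opT))"
    using one_in_approx_point_spec_adj_T00 by (metis complex_cnj_one imageI)
  then show "cnj ` approx_point_spec compC (adj compC compC (T00 l2 opT))
      \<inter> approx_point_spec compAB (T11 l2 opT) \<noteq> {}"
    using one_in_approx_point_spec_T11 by blast
  \<comment> \<open>\<open>opT\<close> has no eigenvalue at all in the open disc.\<close>
  show "point_spec l2 opT \<inter> cnj ` point_spec l2 (adj l2 l2 opT) \<inter> {z. cmod z < 1} = {}"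
    using opT_no_eigenvalue by (auto simp: point_spec_def)
  show "\<not> (\<exists>M0 M1. closed_subspace M0 \<and> closed_subspace M1 \<and> M0 \<subseteq> l2 \<and> M1 \<subseteq> l2
          \<and> (\<forall>x\<in>M0. opT x \<in> M0) \<and> (\<forall>x\<in>M1. opT x \<in> M1)
          \<and> M0 \<inter> M1 = {vzero} \<and> {vadd x y | x y. x \<in> M0 \<and> y \<in> M1} = l2
          \<and> M0 \<noteq> {vzero} \<and> M0 \<subseteq> compC)"
  proof (intro notI, elim exE conjE)
    fix M0 M1 assume "closed_subspace M0" "closed_subspace M1" "\<forall>x\<in>M0. opT x \<in> M0" "\<forall>x\<in>M1. opT x \<in> M1"
      "M0 \<inter> M1 = {vzero}" "{vadd x y | x y. x \<in> M0 \<and> y \<in> M1} = l2" "M0 \<noteq> {vzero}" "M0 \<subseteq> compC"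
    then show False
      by (intro opT_no_decomposition[of M0 M1]) (simp_all add: closed_subspace_def)
  qed
  show "\<forall>K J W. min_unitary_dilation (Hplus l2 opT) (V_T l2 opT) K J W \<longrightarrow>
          (\<exists>C1 C2 D. gamma_rel l2 opT K J W C1 D \<and> gamma_rel l2 opT K J W C2 D
              \<and> (\<exists>x\<in>l2. C1 x \<noteq> C2 x))"
  proof (intro allI impI)
    fix K J W assume dil: "min_unitary_dilation (Hplus l2 opT) (V_T l2 opT) K J W"
    \<comment> \<open>\<open>opC\<close> maps \<open>f_0\<close> to \<open>f_0 - wt 0 f_1\<close>,
      which separates it from the zero operator.\<close>
    let ?f = "mk3 vzero vzero (unit_vec 0)"
    have "gamma_rel l2 opT K J W opC (\<lambda>x. vzero)"
      using gamma_rel_zero[OF dil opC_in_commutant] opC_compC by blast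
    moreover have "gamma_rel l2 opT K J W (\<lambda>x. vzero) (\<lambda>x. vzero)"
      using gamma_rel_zero[OF dil zero_in_commutant[OF bounded_op_opT vzero_in_l2]]
        lin_subspaceD(2)[OF lin_subspace_compC] by blast
    moreover have "opC ?f \<noteq> vzero"
    proof
      assume "opC ?f = vzero"
      then have "pC (opC ?f) 0 = pC vzero 0" by metis
      then show False by (simp add: unit_vec_def)
    qed
    ultimately show "\<exists>C1 C2 D. gamma_rel l2 opT K J W C1 D \<and> gamma_rel l2 opT K J W C2 D
              \<and> (\<exists>x\<in>l2. C1 x \<noteq> C2 x)"
      by (intro exI[of _ opC] exI[of _ "\<lambda>x. vzero"] conjI bexI[of _ ?f]) simp_all
  qed
qed (fact closed_subspace_l2 contraction_opT)+

end
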